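(* Fix a field and a degree $d\ge 0$. Let $\Phi$ and $\Psi$ be data sets with domains $X$ and $Y$, and let $\alpha\colon\Phi\to\Psi$ be a geometric function. (i) For every $\phi\in\Phi$ and $(r,s)\in[0,\infty)\times\mathbf{R}$, any realization $f\colon Y\to X$ of $\alpha$ restricts to a simplicial map $f_{r,s}\colon \mathrm{VR}_r(\alpha(\phi)\le s,d_\Psi)\to \mathrm{VR}_r(\phi\le s,d_\Phi)$, and the induced linear map $$H_d(f_{r,s})\colon PH_d^{\Psi}(\alpha(\phi))_{r,s}\to PH_d^{\Phi}(\phi)_{r,s}$$ depends only on $\alpha$ and not on the choice of the realization $f$. Denote it by $PH_d^{\alpha}(\phi)_{r,s}$. (ii) For every $\phi\in\Phi$, the maps $PH_d^{\alpha}(\phi)_{r,s}$ are natural in $(r,s)$, i.e. they form a natural transformation $PH_d^{\alpha}(\phi)\colon PH_d^{\Psi}(\alpha(\phi))\to PH_d^{\Phi}(\phi)$ of functors on the poset $[0,\infty)\times\mathbf{R}$. (iii) If $\beta\colon\Psi\to\Xi$ is another geometric function between data sets, then $\beta\alpha\colon\Phi\to\Xi$ is geometric and, for every $\phi\in\Phi$, $$PH_d^{\beta\alpha}(\phi)=PH_d^{\alpha}(\phi)\,PH_d^{\beta}(\alpha(\phi)).$$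
   Context: A data set is a finite set $\Phi=\{\phi_i\colon X\to\mathbf{R}\mid i=1,\dots,m\}$ of real-valued functions (measurements) on a finite set $X$, called the domain of $\Phi$. It induces the pseudometric $d_\Phi(x,y)=\max_{1\le i\le m}|\phi_i(x)-\phi_i(y)|$ on $X$. For $\phi\in\Phi$ and $s\in\mathbf{R}$, write $(\phi\le s):=\phi^{-1}((-\infty,s])\subset X$. For $r\ge0$, $\mathrm{VR}_r(\phi\le s,d_\Phi)$ is the Vietoris-Rips complex, whose simplices are the (nonempty) subsets of $(\phi\le s)$ of diameter not exceeding $r$ with respect to $d_\Phi$. Persistent homology is $$PH_d^\Phi(\phi)_{r,s}:=H_d(\mathrm{VR}_r(\phi\le s,d_\Phi)),$$ where $H_d$ is degree $d$ homology with coefficients in the fixed field. For $r\le r'$, $s\le s'$, the map $PH_d^\Phi(\phi)_{r,s}\to PH_d^\Phi(\phi)_{r',s'}$ is induced by the inclusion of complexes; this makes $PH_d^\Phi(\phi)$ a functor from the poset $[0,\infty)\times\mathbf{R}$ (product order) to vector spaces. A function $\alpha\colon\Phi\to\Psi$ between data sets with domains $X$ and $Y$ is geometric if there is a function $f\colon Y\to X$, called a realization of $\alpha$, such that $\alpha(\phi)=\phi f$ for every $\phi\in\Phi$. *)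

theory Defs
  imports Complex_Main "HOL-Library.FuncSet" "HOL-Algebra.AbelCoset" "Jordan_Normal_Form.VS_Connect"
begin

section \<open>Oriented simplicial homology with coefficients in a field\<close>

text \<open>
  An ordered simplex $(v_0,\dots,v_d)$ of a simplicial complex \<open>K\<close> (given by its set of
  nonempty finite simplices) is a distinct list.  A \<open>d\<close>-chain is a finitely supported function
  on the ordered \<open>d\<close>-simplices which changes sign with the orientation, i.e. under every
  transposition of two vertices (hence by the sign of any permutation).  The oriented simplex
  $[v_0,\dots,v_d]$ is the chain supported on the orderings of $\{v_0,\dots,v_d\}$ with value
  \<open>1\<close> at $(v_0,\dots,v_d)$; these span the chain space.
\<close>

definition alternating :: "('a list \<Rightarrow> 'k::field) \<Rightarrow> bool" where
  "alternating c \<longleftrightarrow>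
     (\<forall>xs i j. i < j \<longrightarrow> j < length xs \<longrightarrow> c (xs[i := xs ! j, j := xs ! i]) = - c xs)"

definition chains :: "'a set set \<Rightarrow> nat \<Rightarrow> ('a list \<Rightarrow> 'k::field) set" where
  "chains K d = {c. alternating c \<and> finite {xs. c xs \<noteq> 0} \<and>
     (\<forall>xs. c xs \<noteq> 0 \<longrightarrow> length xs = Suc d \<and> distinct xs \<and> set xs \<in> K)}"

definition chain_space :: "'a set set \<Rightarrow> nat \<Rightarrow> ('k::field, 'a list \<Rightarrow> 'k) module" where
  "chain_space K d =
     \<lparr>carrier = chains K d, mult = undefined, one = undefined, zero = (\<lambda>_. 0),
      add = (\<lambda>c e xs. c xs + e xs), smult = (\<lambda>k c xs. k * c xs)\<rparr>"

text \<open>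
  In terms of coefficients, $\partial[v_0,\dots,v_d]=\sum_i(-1)^i[v_0,\dots,\hat v_i,\dots,v_d]$
  reads $(\partial c)(y)=\sum_x c(x,y)$, because
  $[v_0,\dots,v_d]=(-1)^i[v_i,v_0,\dots,\hat v_i,\dots,v_d]$; see \<open>boundary_oriented_simplex\<close>.
  The complex is not augmented: the boundary of a \<open>0\<close>-chain vanishes.
\<close>

definition boundary :: "('a list \<Rightarrow> 'k::field) \<Rightarrow> 'a list \<Rightarrow> 'k" where
  "boundary c ys = (if ys = [] then 0 else \<Sum>x | c (x # ys) \<noteq> 0. c (x # ys))"

definition cycles :: "'a set set \<Rightarrow> nat \<Rightarrow> ('a list \<Rightarrow> 'k::field) set" where
  "cycles K d = {c \<in> chains K d. boundary c = (\<lambda>_. 0)}"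

definition boundaries :: "'a set set \<Rightarrow> nat \<Rightarrow> ('a list \<Rightarrow> 'k::field) set" where
  "boundaries K d = boundary ` chains K (Suc d)"

definition quotient_space ::
  "('k, 'v, 'm) module_scheme \<Rightarrow> 'v set \<Rightarrow> ('k, 'v set) module" where
  "quotient_space V W =
     \<lparr>carrier = a_rcosets\<^bsub>V\<^esub> W, mult = undefined, one = undefined, zero = W,
      add = (\<lambda>A B. A <+>\<^bsub>V\<^esub> B), smult = (\<lambda>k A. \<Union>a\<in>A. W +>\<^bsub>V\<^esub> (k \<odot>\<^bsub>V\<^esub> a))\<rparr>"

definition homology :: "'a set set \<Rightarrow> nat \<Rightarrow> ('k::field, ('a list \<Rightarrow> 'k) set) module" where
  "homology K d = quotient_space (chain_space K d\<lparr>carrier := cycles K d\<rparr>) (boundaries K d)"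

definition simplicial_map :: "'a set set \<Rightarrow> 'b set set \<Rightarrow> ('a \<Rightarrow> 'b) \<Rightarrow> bool" where
  "simplicial_map K L f \<longleftrightarrow> (\<forall>\<sigma>\<in>K. f ` \<sigma> \<in> L)"

text \<open>
  The linear map $[v_0,\dots,v_d]\mapsto[f v_0,\dots,f v_d]$, where the right-hand side is read
  as \<open>0\<close> if $f$ identifies two of the $v_i$; see \<open>pushforward_oriented_simplex\<close>.  The summands
  belonging to such degenerate images cancel because chains are alternating.
\<close>

definition pushforward :: "('a \<Rightarrow> 'b) \<Rightarrow> ('a list \<Rightarrow> 'k::field) \<Rightarrow> 'b list \<Rightarrow> 'k" where
  "pushforward f c ys = (\<Sum>xs | map f xs = ys \<and> c xs \<noteq> 0. c xs)"

definition homology_map ::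
  "'a set set \<Rightarrow> 'b set set \<Rightarrow> nat \<Rightarrow> ('a \<Rightarrow> 'b) \<Rightarrow>
     ('a list \<Rightarrow> 'k::field) set \<Rightarrow> ('b list \<Rightarrow> 'k) set" where
  "homology_map K L d f =
     (\<lambda>A\<in>carrier (homology K d). \<Union>c\<in>A. boundaries L d +>\<^bsub>chain_space L d\<^esub> pushforward f c)"

lemma alternating_Cons: "alternating c \<Longrightarrow> alternating (\<lambda>ys. c (x # ys))"
  unfolding alternating_def
proof (intro allI impI)
  fix xs :: "'a list" and i j
  assume c: "\<forall>xs i j. i < j \<longrightarrow> j < length xs \<longrightarrow> c (xs[i := xs ! j, j := xs ! i]) = - c xs"
    and ij: "i < j" "j < length xs"
  show "c (x # xs[i := xs ! j, j := xs ! i]) = - c (x # xs)"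
    using c[rule_format, of "Suc i" "Suc j" "x # xs"] ij by simp
qed

lemma alternating_move:
  "alternating c \<Longrightarrow> c (as @ x # bs) = (-1) ^ length as * c (x # as @ bs)"
proof (induction as arbitrary: c)
  case Nil
  then show ?case by simp
next
  case (Cons a as)
  have "c (a # as @ x # bs) = (-1) ^ length as * c (a # x # as @ bs)"
    using Cons.IH[OF alternating_Cons[OF Cons.prems]] by simp
  moreover have "c (a # x # as @ bs) = - c (x # a # as @ bs)"
    using Cons.prems[unfolded alternating_def, rule_format, of 0 1 "x # a # as @ bs"] by simp
  ultimately show ?case by simp
qed

lemma boundary_oriented_simplex:
  assumes c: "c \<in> chains K (Suc d)" and xs: "c xs = 1"
    and supp: "\<forall>ys. c ys \<noteq> 0 \<longrightarrow> set ys = set xs"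
    and i: "i \<le> Suc d"
  shows "boundary c (take i xs @ drop (Suc i) xs) = (-1) ^ i"
proof -
  let ?ys = "take i xs @ drop (Suc i) xs"
  have len: "length xs = Suc (Suc d)" and dist: "distinct xs"
    using c xs by (auto simp: chains_def)
  have split: "xs = take i xs @ xs ! i # drop (Suc i) xs"
    using id_take_nth_drop[of i xs] i len by simp
  have ne: "?ys \<noteq> []" using i len by auto
  have "c xs = c (take i xs @ xs ! i # drop (Suc i) xs)"
    by (rule arg_cong[OF split])
  also have "\<dots> = (-1) ^ length (take i xs) * c (xs ! i # ?ys)"
    using c by (intro alternating_move) (simp add: chains_def)
  also have "length (take i xs) = i"
    using i len by simp
  finally have "c xs = (-1) ^ i * c (xs ! i # ?ys)" .
  then have val: "c (xs ! i # ?ys) = (-1) ^ i"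
    using xs left_minus_one_mult_self[of i "c (xs ! i # ?ys)"] by simp
  have "{x. c (x # ?ys) \<noteq> 0} = {xs ! i}"
  proof (intro equalityI subsetI)
    fix x assume "x \<in> {x. c (x # ?ys) \<noteq> 0}"
    then have x: "c (x # ?ys) \<noteq> 0" by simp
    have "set (x # ?ys) = set xs" using supp x by blast
    moreover have "distinct (x # ?ys)" using x c unfolding chains_def by blast
    moreover have "set xs = insert (xs ! i) (set ?ys)" by (subst split) auto
    ultimately show "x \<in> {xs ! i}" by (metis distinct.simps(2) insertE insertI1 list.set(2) singletonI)
  qed (use val in simp)
  then show ?thesis using val ne by (simp add: boundary_def)
qed

lemma sum_involution_eq_0:
  fixes g :: "'b \<Rightarrow> 'k::field"
  assumes "finite S" and "\<And>v. v \<in> S \<Longrightarrow> t v \<in> S \<and> t v \<noteq> v \<and> t (t v) = v \<and> g (t v) = - g v"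
  shows "sum g S = 0"
  using assms
proof (induction "card S" arbitrary: S rule: less_induct)
  case less
  show ?case
  proof (cases "S = {}")
    case False
    then obtain v where v: "v \<in> S" by blast
    let ?S = "S - {v, t v}"
    have "sum g ?S = 0"
    proof (rule less.hyps)
      show "card ?S < card S"
        by (rule psubset_card_mono) (use less.prems v in auto)
      show "finite ?S" using less.prems by simp
      show "t w \<in> ?S \<and> t w \<noteq> w \<and> t (t w) = w \<and> g (t w) = - g w" if w: "w \<in> ?S" for w
      proof -
        have "t w \<noteq> v" using w less.prems(2)[of w] less.prems(2)[OF v] by auto
        moreover have "t w \<noteq> t v"
        proof
          assume "t w = t v"
          then have "t (t w) = t (t v)" by simp
          then show False using w less.prems(2)[of w] less.prems(2)[OF v] by auto
        qed
        ultimately show ?thesis using w less.prems(2)[of w] by auto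
      qed
    qed
    moreover have "sum g S = g v + (g (t v) + sum g ?S)"
    proof -
      have "sum g S = g v + sum g (S - {v})"
        using less.prems(1) v by (rule sum.remove)
      also have "sum g (S - {v}) = g (t v) + sum g (S - {v} - {t v})"
        by (rule sum.remove) (use less.prems v in auto)
      also have "S - {v} - {t v} = ?S" by auto
      finally show ?thesis .
    qed
    ultimately show ?thesis using less.prems(2)[OF v] by simp
  qed simp
qed

lemma pushforward_oriented_simplex:
  assumes c: "c \<in> chains K d" and xs: "c xs = 1"
    and supp: "\<forall>ys. c ys \<noteq> 0 \<longrightarrow> set ys = set xs"
  shows "inj_on f (set xs) \<Longrightarrow> pushforward f c (map f xs) = 1"
    and "\<not> inj_on f (set xs) \<Longrightarrow> pushforward f c = (\<lambda>_. 0)"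
proof -
  assume inj: "inj_on f (set xs)"
  have "{ys. map f ys = map f xs \<and> c ys \<noteq> 0} = {xs}"
  proof (intro equalityI subsetI)
    fix ys assume "ys \<in> {ys. map f ys = map f xs \<and> c ys \<noteq> 0}"
    then have "map f ys = map f xs" "set ys = set xs" using supp by auto
    then show "ys \<in> {xs}" using inj by (metis Un_absorb map_inj_on singletonI)
  qed (use xs in simp)
  then show "pushforward f c (map f xs) = 1" using xs by (simp add: pushforward_def)
next
  assume ninj: "\<not> inj_on f (set xs)"
  show "pushforward f c = (\<lambda>_. 0)"
  proof
    fix ys
    let ?S = "{vs. map f vs = ys \<and> c vs \<noteq> 0}"
    show "pushforward f c ys = 0"
    proof (cases "?S = {}")
      case True
      show ?thesis unfolding pushforward_def True by simp
    next
      case False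
      then obtain us where us: "map f us = ys" "c us \<noteq> 0" by blast
      have "set us = set xs" "distinct us" using us supp c by (auto simp: chains_def)
      then have "\<not> distinct ys" using us ninj by (auto simp: distinct_map)
      then obtain i j where ij: "i < j" "j < length ys" "ys ! i = ys ! j"
        by (metis distinct_conv_nth linorder_neqE_nat)
      let ?t = "\<lambda>vs. vs[i := vs ! j, j := vs ! i] :: 'a list"
      have "sum c ?S = 0"
      proof (rule sum_involution_eq_0[where t = ?t])
        have "finite {vs. c vs \<noteq> 0}" using c by (auto simp: chains_def)
        then show "finite ?S" by (rule rev_finite_subset) auto
        fix vs assume vs: "vs \<in> ?S"
        then have len: "length vs = length ys" by auto
        have neq: "vs ! i \<noteq> vs ! j"
          using vs c ij len by (auto simp: chains_def nth_eq_iff_index_eq)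
        have sgn: "c (?t vs) = - c vs"
          using c ij len by (auto simp: chains_def alternating_def)
        have "f (vs ! i) = f (vs ! j)"
        proof -
          have "ys ! i = f (vs ! i)" "ys ! j = f (vs ! j)"
            using vs ij(1,2) len nth_map[of _ vs f] by auto
          then show ?thesis using ij(3) by simp
        qed
        then have "map f (?t vs) = map f vs"
          using ij len by (intro nth_equalityI) (auto simp: nth_list_update)
        moreover have "?t vs \<noteq> vs"
        proof
          assume "?t vs = vs"
          then have "?t vs ! j = vs ! j" by simp
          then show False using neq ij len by simp
        qed
        moreover have "?t (?t vs) = vs"
          using ij len by (intro nth_equalityI) (auto simp: nth_list_update)
        ultimately show "?t vs \<in> ?S \<and> ?t vs \<noteq> vs \<and> ?t (?t vs) = vs \<and> c (?t vs) = - c vs"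
          using vs sgn by auto
      qed
      then show ?thesis by (simp add: pushforward_def)
    qed
  qed
qed


section \<open>Data sets and their persistent homology\<close>

text \<open>
  Measurements are normalised to be \<open>undefined\<close> outside the domain, so that equality of
  HOL functions is equality of functions on the domain.
\<close>

record 'x data_set =
  ds_domain :: "'x set"
  measurements :: "('x \<Rightarrow> real) set"

definition is_data_set :: "'x data_set \<Rightarrow> bool" where
  "is_data_set \<Phi> \<longleftrightarrow> finite (ds_domain \<Phi>) \<and> finite (measurements \<Phi>) \<and>
     measurements \<Phi> \<subseteq> extensional (ds_domain \<Phi>)"

definition data_dist :: "'x data_set \<Rightarrow> 'x \<Rightarrow> 'x \<Rightarrow> real" where
  "data_dist \<Phi> x y = Max ((\<lambda>\<phi>. \<bar>\<phi> x - \<phi> y\<bar>) ` measurements \<Phi>)"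

definition sublevel :: "'x data_set \<Rightarrow> ('x \<Rightarrow> real) \<Rightarrow> real \<Rightarrow> 'x set" where
  "sublevel \<Phi> \<phi> s = {x \<in> ds_domain \<Phi>. \<phi> x \<le> s}"

definition finite_diameter :: "('x \<Rightarrow> 'x \<Rightarrow> real) \<Rightarrow> 'x set \<Rightarrow> real" where
  "finite_diameter \<delta> \<sigma> = Max ((\<lambda>(x, y). \<delta> x y) ` (\<sigma> \<times> \<sigma>))"

definition vietoris_rips :: "real \<Rightarrow> 'x set \<Rightarrow> ('x \<Rightarrow> 'x \<Rightarrow> real) \<Rightarrow> 'x set set" where
  "vietoris_rips r S \<delta> = {\<sigma>. \<sigma> \<noteq> {} \<and> finite \<sigma> \<and> \<sigma> \<subseteq> S \<and> finite_diameter \<delta> \<sigma> \<le> r}"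

abbreviation VR :: "'x data_set \<Rightarrow> ('x \<Rightarrow> real) \<Rightarrow> real \<Rightarrow> real \<Rightarrow> 'x set set" where
  "VR \<Phi> \<phi> r s \<equiv> vietoris_rips r (sublevel \<Phi> \<phi> s) (data_dist \<Phi>)"

definition PH :: "nat \<Rightarrow> 'x data_set \<Rightarrow> ('x \<Rightarrow> real) \<Rightarrow> real \<Rightarrow> real \<Rightarrow>
    ('k::field, ('x list \<Rightarrow> 'k) set) module" where
  "PH d \<Phi> \<phi> r s = homology (VR \<Phi> \<phi> r s) d"

definition PH_transition :: "nat \<Rightarrow> 'x data_set \<Rightarrow> ('x \<Rightarrow> real) \<Rightarrow>
    real \<Rightarrow> real \<Rightarrow> real \<Rightarrow> real \<Rightarrow> ('x list \<Rightarrow> 'k::field) set \<Rightarrow> ('x list \<Rightarrow> 'k) set" where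
  "PH_transition d \<Phi> \<phi> r s r' s' = homology_map (VR \<Phi> \<phi> r s) (VR \<Phi> \<phi> r' s') d (\<lambda>x. x)"

definition realization ::
  "'x data_set \<Rightarrow> 'y data_set \<Rightarrow> (('x \<Rightarrow> real) \<Rightarrow> 'y \<Rightarrow> real) \<Rightarrow> ('y \<Rightarrow> 'x) \<Rightarrow> bool" where
  "realization \<Phi> \<Psi> \<alpha> f \<longleftrightarrow> f \<in> ds_domain \<Psi> \<rightarrow> ds_domain \<Phi> \<and>
     (\<forall>\<phi>\<in>measurements \<Phi>. \<alpha> \<phi> = compose (ds_domain \<Psi>) \<phi> f)"

definition geometric ::
  "'x data_set \<Rightarrow> 'y data_set \<Rightarrow> (('x \<Rightarrow> real) \<Rightarrow> 'y \<Rightarrow> real) \<Rightarrow> bool" where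
  "geometric \<Phi> \<Psi> \<alpha> \<longleftrightarrow>
     \<alpha> \<in> measurements \<Phi> \<rightarrow> measurements \<Psi> \<and> (\<exists>f. realization \<Phi> \<Psi> \<alpha> f)"

abbreviation realization_map :: "nat \<Rightarrow> 'x data_set \<Rightarrow> 'y data_set \<Rightarrow>
    (('x \<Rightarrow> real) \<Rightarrow> 'y \<Rightarrow> real) \<Rightarrow> ('x \<Rightarrow> real) \<Rightarrow> real \<Rightarrow> real \<Rightarrow> ('y \<Rightarrow> 'x) \<Rightarrow>
    ('y list \<Rightarrow> 'k::field) set \<Rightarrow> ('x list \<Rightarrow> 'k) set" where
  "realization_map d \<Phi> \<Psi> \<alpha> \<phi> r s f \<equiv> homology_map (VR \<Psi> (\<alpha> \<phi>) r s) (VR \<Phi> \<phi> r s) d f"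

definition PH_map :: "nat \<Rightarrow> 'x data_set \<Rightarrow> 'y data_set \<Rightarrow>
    (('x \<Rightarrow> real) \<Rightarrow> 'y \<Rightarrow> real) \<Rightarrow> ('x \<Rightarrow> real) \<Rightarrow> real \<Rightarrow> real \<Rightarrow>
    ('y list \<Rightarrow> 'k::field) set \<Rightarrow> ('x list \<Rightarrow> 'k) set" where
  "PH_map d \<Phi> \<Psi> \<alpha> \<phi> r s =
     (THE h. \<exists>f. realization \<Phi> \<Psi> \<alpha> f \<and> h = realization_map d \<Phi> \<Psi> \<alpha> \<phi> r s f)"


section \<open>Functors on the poset of pairs \<open>(r, s)\<close> with \<open>0 \<le> r\<close>\<close>

text \<open>
  A functor to vector spaces is given by spaces \<open>V r s\<close> and maps \<open>t r s r' s'\<close>, which are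
  extensional on their source space (\<open>compose\<close> and \<open>restrict\<close> of \<open>HOL-Library.FuncSet\<close>), so
  that equality of HOL functions is equality of linear maps.
\<close>

definition persistence_functor ::
  "(real \<Rightarrow> real \<Rightarrow> ('k::field, 'v) module) \<Rightarrow>
   (real \<Rightarrow> real \<Rightarrow> real \<Rightarrow> real \<Rightarrow> 'v \<Rightarrow> 'v) \<Rightarrow> bool" where
  "persistence_functor V t \<longleftrightarrow>
     (\<forall>r s r' s'. 0 \<le> r \<longrightarrow> r \<le> r' \<longrightarrow> s \<le> s' \<longrightarrow>
        linear_map class_ring (V r s) (V r' s') (t r s r' s')) \<and>
     (\<forall>r s. 0 \<le> r \<longrightarrow> t r s r s = (\<lambda>v\<in>carrier (V r s). v)) \<and>
     (\<forall>r s r' s' r'' s''. 0 \<le> r \<longrightarrow> r \<le> r' \<longrightarrow> r' \<le> r'' \<longrightarrow> s \<le> s' \<longrightarrow> s' \<le> s'' \<longrightarrow>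
        t r s r'' s'' = compose (carrier (V r s)) (t r' s' r'' s'') (t r s r' s'))"

definition natural_transformation ::
  "(real \<Rightarrow> real \<Rightarrow> ('k::field, 'v) module) \<Rightarrow> (real \<Rightarrow> real \<Rightarrow> real \<Rightarrow> real \<Rightarrow> 'v \<Rightarrow> 'v) \<Rightarrow>
   (real \<Rightarrow> real \<Rightarrow> ('k, 'w) module) \<Rightarrow> (real \<Rightarrow> real \<Rightarrow> real \<Rightarrow> real \<Rightarrow> 'w \<Rightarrow> 'w) \<Rightarrow>
   (real \<Rightarrow> real \<Rightarrow> 'v \<Rightarrow> 'w) \<Rightarrow> bool" where
  "natural_transformation V t W u \<eta> \<longleftrightarrow>
     persistence_functor V t \<and> persistence_functor W u \<and>
     (\<forall>r s. 0 \<le> r \<longrightarrow> linear_map class_ring (V r s) (W r s) (\<eta> r s)) \<and>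
     (\<forall>r s r' s'. 0 \<le> r \<longrightarrow> r \<le> r' \<longrightarrow> s \<le> s' \<longrightarrow>
        compose (carrier (V r s)) (u r s r' s') (\<eta> r s) =
        compose (carrier (V r s)) (\<eta> r' s') (t r s r' s'))"

end

theory Submission
  imports Defs
begin

text \<open>
  If \<open>f\<close> and \<open>g\<close> realize the same \<open>\<alpha>\<close>, then $\phi(f(y)) = \alpha(\phi)(y) = \phi(g(y))$
  for every measurement $\phi$, so $f(\sigma)\cup g(\sigma)$ has the same diameter bound as
  $\sigma$: the two maps are contiguous and hence agree on homology.  Contiguity is reduced to
  maps \<open>f\<close>, \<open>g\<close> that differ at a single vertex \<open>v\<close>.  There, for a cycle \<open>c\<close> with
  link $e$ at \<open>v\<close> (evaluate \<open>c\<close> at \<open>v\<close> and push forward),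
  $g_\# c - f_\# c = g(v)\wedge e - f(v)\wedge e = \partial(f(v)\wedge g(v)\wedge e)$,
  because $\partial(a\wedge e) = e - a\wedge\partial e$ and $\partial e = 0$.
\<close>

section \<open>Alternating chains\<close>

text \<open>Two conventions shape the argument. The complex is not augmented, yet for a cycle of
  degree 0 the link e is a multiple of the empty simplex, and \<partial>(a\<and>e) = e -
  a\<and>\<partial>e already fails for the unaugmented boundary when e is a single vertex. The
  calculus is therefore carried out with an augmented boundary on functions of lists of all lengths;
  the convention at the empty list enters only when the result is compared with
  \<open>boundary\<close>. Also, the field may have characteristic 2, where a change of sign under
  transpositions does not make coefficients at repeated vertices vanish. That vanishing is carried
  as a separate condition, because it is what cancels degenerate images. The link of a cycle is
  closed because the coefficient of \<partial>e at a list xs is, up to sign and before pushing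
  forward, the coefficient of \<partial>c at v followed by xs. That list is never empty, so the
  cycle condition applies in degree 0 as well.\<close>

text \<open>Both clauses concern neighbouring positions behind a prefix \<open>ps\<close>: this form
  passes to the function obtained by fixing the first vertex, and it can be verified by induction on
  \<open>ps\<close>.\<close>

definition exterior :: "('a list \<Rightarrow> 'k::field) \<Rightarrow> bool" where
  "exterior c \<longleftrightarrow>
     (\<forall>ps x y zs. c (ps @ x # y # zs) = - c (ps @ y # x # zs) \<and> c (ps @ x # x # zs) = 0)"

lemma exteriorD:
  assumes "exterior c"
  shows "c (ps @ x # y # zs) = - c (ps @ y # x # zs)" "c (ps @ x # x # zs) = 0"
  using assms unfolding exterior_def by blast+

lemma exterior_swap: "exterior c \<Longrightarrow> c (x # y # zs) = - c (y # x # zs)"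
  using exteriorD(1)[of c "[]" x y zs] by simp

lemma exterior_repeat: "exterior c \<Longrightarrow> c (x # x # zs) = 0"
  using exteriorD(2)[of c "[]" x zs] by simp

lemma exterior_Cons: "exterior c \<Longrightarrow> exterior (\<lambda>xs. c (x # xs))"
  unfolding exterior_def by (metis append_Cons)

text \<open>Moving \<open>x\<close> to the front of \<open>as\<close> takes one adjacent swap for
  each entry of \<open>as\<close>.\<close>

lemma exterior_move:
  "exterior c \<Longrightarrow> c (ps @ as @ x # bs) = (-1) ^ length as * c (ps @ x # as @ bs)"
proof (induction as arbitrary: ps)
  case (Cons a as)
  have "c (ps @ (a # as) @ x # bs) = (-1) ^ length as * c (ps @ a # x # as @ bs)"
    using Cons.IH[of "ps @ [a]"] Cons.prems by simp
  then show ?case using exteriorD(1)[OF Cons.prems, of ps a x "as @ bs"] by simp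
qed simp

text \<open>To transpose two distant entries, the second is moved next to the first in both
  orderings; the two moves contribute the same sign, so only the sign of one adjacent swap is left.
  A repeated entry is likewise moved next to its copy. Conversely, an adjacent swap is the
  transposition of positions \<open>length ps\<close> and \<open>Suc (length ps)\<close>.\<close>

lemma exterior_iff:
  "exterior c \<longleftrightarrow> alternating c \<and> (\<forall>xs. c xs \<noteq> 0 \<longrightarrow> distinct xs)"
proof (intro iffI conjI allI impI)
  assume c: "exterior c"
  show "alternating c"
    unfolding alternating_def
  proof (intro allI impI)
    fix xs :: "'a list" and i j
    assume ij: "i < j" "j < length xs"
    define ps bs cs where "ps = take i xs" and "bs = take (j - Suc i) (drop (Suc i) xs)"
      and "cs = drop (Suc j) xs"
    have tail: "drop (Suc i) xs = bs @ xs ! j # cs"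
      using id_take_nth_drop[of "j - Suc i" "drop (Suc i) xs"] ij by (simp add: bs_def cs_def)
    have xs: "xs = ps @ xs ! i # bs @ xs ! j # cs"
      using id_take_nth_drop[of i xs] ij tail by (simp add: ps_def)
    have len: "length ps = i" "length bs = j - Suc i" using ij by (auto simp: ps_def bs_def)
    have j: "j = Suc (i + length bs)" using ij len by simp
    have swap: "xs[i := xs ! j, j := xs ! i] = ps @ xs ! j # bs @ xs ! i # cs"
    proof -
      have "(ps @ x # bs @ y # cs)[i := y, j := x] = ps @ y # bs @ x # cs" for x y
        unfolding j by (simp add: list_update_append len(1))
      then show ?thesis using xs by metis
    qed
    have move: "c (ps @ x # bs @ y # cs) = (-1) ^ length bs * c (ps @ x # y # bs @ cs)" for x y
      using exterior_move[OF c, of "ps @ [x]" bs y cs] by simp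
    have "c (xs[i := xs ! j, j := xs ! i]) = c (ps @ xs ! j # bs @ xs ! i # cs)"
      by (simp only: swap)
    also have "\<dots> = - c (ps @ xs ! i # bs @ xs ! j # cs)"
      unfolding move using exteriorD(1)[OF c, of ps "xs ! j" "xs ! i" "bs @ cs"] by simp
    also have "c (ps @ xs ! i # bs @ xs ! j # cs) = c xs"
      by (rule arg_cong[OF xs[symmetric]])
    finally show "c (xs[i := xs ! j, j := xs ! i]) = - c xs" .
  qed
next
  fix xs assume c: "exterior c" and xs: "c xs \<noteq> 0"
  show "distinct xs"
  proof (rule ccontr)
    assume "\<not> distinct xs"
    then obtain as bs cs y where "xs = as @ [y] @ bs @ [y] @ cs"
      using not_distinct_decomp by blast
    then show False
      using xs exterior_move[OF c, of "as @ [y]" bs y cs] exteriorD(2)[OF c] by simp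
  qed
next
  assume *: "alternating c \<and> (\<forall>xs. c xs \<noteq> 0 \<longrightarrow> distinct xs)"
  show "exterior c"
    unfolding exterior_def
  proof (intro allI conjI)
    fix ps zs :: "'a list" and x y
    show "c (ps @ x # y # zs) = - c (ps @ y # x # zs)"
      using *[THEN conjunct1, unfolded alternating_def, rule_format,
          of "length ps" "Suc (length ps)" "ps @ y # x # zs"]
      by (simp add: nth_append list_update_append)
    show "c (ps @ x # x # zs) = 0"
      using * by (metis distinct_append distinct_length_2_or_more)
  qed
qed

definition supported :: "'a set \<Rightarrow> ('a list \<Rightarrow> 'k::field) \<Rightarrow> bool" where
  "supported V c \<longleftrightarrow> (\<forall>xs. c xs \<noteq> 0 \<longrightarrow> set xs \<subseteq> V)"

lemma supported_Cons: "supported V c \<Longrightarrow> supported V (\<lambda>xs. c (x # xs))"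
  unfolding supported_def by (metis insert_subset list.simps(15))

lemma supported_Cons_eq_0: "supported V c \<Longrightarrow> x \<notin> V \<Longrightarrow> c (x # xs) = 0"
  unfolding supported_def by (metis insert_subset list.simps(15))


subsection \<open>The augmented boundary\<close>

text \<open>Unlike \<open>boundary\<close>, this is not set to \<open>0\<close> on the empty list.\<close>

definition aug_boundary :: "'a set \<Rightarrow> ('a list \<Rightarrow> 'k::field) \<Rightarrow> 'a list \<Rightarrow> 'k" where
  "aug_boundary V c ys = (\<Sum>x\<in>V. c (x # ys))"

text \<open>\<open>boundary\<close> sums over an index set that depends on \<open>c\<close>. The
  fixed set \<open>V\<close> makes linearity and exchange of sums immediate.\<close>

lemma boundary_eq_aug_boundary:
  assumes "finite V" "supported V c"
  shows "boundary c ys = (if ys = [] then 0 else aug_boundary V c ys)"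
proof -
  have "(\<Sum>x | c (x # ys) \<noteq> 0. c (x # ys)) = (\<Sum>x\<in>V. c (x # ys))"
    by (rule sum.mono_neutral_left) (use assms supported_Cons_eq_0[OF assms(2)] in auto)
  then show ?thesis by (simp add: boundary_def aug_boundary_def)
qed

lemma exterior_aug_boundary:
  assumes "exterior c"
  shows "exterior (aug_boundary V c)"
  unfolding exterior_def aug_boundary_def sum_negf[symmetric]
  by (intro allI conjI sum.cong sum.neutral ballI refl exteriorD[OF exterior_Cons[OF assms]])

text \<open>A new index adds a row and a column that cancel, and a diagonal entry. The diagonal has
  its own hypothesis since antisymmetry does not kill it in characteristic 2.\<close>

lemma sum_antisymmetric_eq_0:
  fixes A :: "'b \<Rightarrow> 'b \<Rightarrow> 'k::ab_group_add"
  assumes swap: "\<And>x y. A x y = - A y x" and diag: "\<And>x. A x x = 0"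
  shows "(\<Sum>x\<in>S. \<Sum>y\<in>S. A x y) = 0"
proof (induction S rule: infinite_finite_induct)
  case (insert s S)
  have "(\<Sum>x\<in>insert s S. \<Sum>y\<in>insert s S. A x y) =
      (\<Sum>y\<in>S. A s y) + ((\<Sum>x\<in>S. A x s) + (\<Sum>x\<in>S. \<Sum>y\<in>S. A x y))"
    using insert.hyps by (simp add: diag sum.distrib)
  also have "(\<Sum>x\<in>S. A x s) = - (\<Sum>y\<in>S. A s y)"
    by (subst swap) (simp add: sum_negf)
  finally show ?case using insert.IH by simp
qed simp_all

text \<open>The coefficient at \<open>ys\<close> is a double sum over the two removed vertices,
  antisymmetric in them.\<close>

lemma aug_boundary_aug_boundary:
  assumes "exterior c"
  shows "aug_boundary V (aug_boundary V c) ys = 0"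
  unfolding aug_boundary_def
  by (rule sum_antisymmetric_eq_0) (rule exterior_swap[OF assms], rule exterior_repeat[OF assms])


subsection \<open>Pushforward\<close>

text \<open>Agreement on the fibre over \<open>ys\<close> suffices. This allows
  \<open>boundary\<close> to be exchanged for \<open>aug_boundary\<close> at nonempty lists,
  although the two may differ at the empty one.\<close>

lemma pushforward_cong:
  assumes "\<And>xs. map f xs = ys \<Longrightarrow> c xs = e xs"
  shows "pushforward f c ys = pushforward f e ys"
  unfolding pushforward_def using assms by (intro sum.cong) auto

lemma pushforward_map_cong:
  assumes "supported V c" "\<And>x. x \<in> V \<Longrightarrow> f x = g x"
  shows "pushforward f c = pushforward g c"
proof -
  have "{xs. map f xs = ys \<and> c xs \<noteq> 0} = {xs. map g xs = ys \<and> c xs \<noteq> 0}" for ys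
  proof -
    have "map f xs = map g xs" if "c xs \<noteq> 0" for xs
      using that assms unfolding supported_def by (intro map_cong) auto
    then show ?thesis by (intro Collect_cong) metis
  qed
  then show ?thesis unfolding pushforward_def by presburger
qed

lemma pushforward_nonzeroE:
  assumes "pushforward f c ys \<noteq> 0"
  obtains xs where "map f xs = ys" "c xs \<noteq> 0"
  using assms unfolding pushforward_def by (metis (mono_tags, lifting) mem_Collect_eq sum.not_neutral_contains_not_neutral)

lemma finite_lists_map_eq: "finite V \<Longrightarrow> finite {xs. set xs \<subseteq> V \<and> map f xs = ys}"
  by (rule finite_subset[OF _ finite_lists_length_eq[of V "length ys"]]) auto

lemma pushforward_eq_sum:
  assumes "finite V" "supported V c"
  shows "pushforward f c ys = (\<Sum>xs | set xs \<subseteq> V \<and> map f xs = ys. c xs)"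
  unfolding pushforward_def
  by (rule sum.mono_neutral_left)
    (use assms finite_lists_map_eq[OF assms(1)] in \<open>auto simp: supported_def\<close>)

lemma pushforward_zero: "pushforward f (\<lambda>_. 0) = (\<lambda>_. 0)"
  by (rule ext) (simp add: pushforward_def)

lemma pushforward_uminus: "pushforward f (\<lambda>xs. - c xs) = (\<lambda>ys. - pushforward f c ys)"
  by (rule ext) (simp add: pushforward_def sum_negf)

lemma pushforward_scale: "pushforward f (\<lambda>xs. k * c xs) = (\<lambda>ys. k * pushforward f c ys)"
  \<comment> \<open>For nonzero \<open>k\<close> the index set of the sum is unchanged; for
    \<open>k = 0\<close> it becomes empty.\<close>
  by (rule ext, cases "k = 0") (simp_all add: pushforward_def sum_distrib_left)

lemma pushforward_add:
  assumes "finite V" "supported V c" "supported V e"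
  shows "pushforward f (\<lambda>xs. c xs + e xs) = (\<lambda>ys. pushforward f c ys + pushforward f e ys)"
proof -
  have "supported V (\<lambda>xs. c xs + e xs)"
    using assms(2,3) unfolding supported_def by (metis add_0)
  then show ?thesis
    using assms by (simp add: fun_eq_iff pushforward_eq_sum[of V] sum.distrib)
qed

lemma pushforward_sum:
  assumes "finite V" "\<And>i. i \<in> I \<Longrightarrow> supported V (c i)"
  shows "pushforward f (\<lambda>xs. \<Sum>i\<in>I. c i xs) ys = (\<Sum>i\<in>I. pushforward f (c i) ys)"
proof -
  have "supported V (\<lambda>xs. \<Sum>i\<in>I. c i xs)"
    using assms(2) unfolding supported_def by (metis (no_types, lifting) sum.neutral)
  then have "pushforward f (\<lambda>xs. \<Sum>i\<in>I. c i xs) ys =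
      (\<Sum>xs | set xs \<subseteq> V \<and> map f xs = ys. \<Sum>i\<in>I. c i xs)"
    by (rule pushforward_eq_sum[OF assms(1)])
  also have "\<dots> = (\<Sum>i\<in>I. pushforward f (c i) ys)"
    by (subst sum.swap) (use assms in \<open>simp add: pushforward_eq_sum[of V]\<close>)
  finally show ?thesis .
qed

lemma pushforward_Nil: "pushforward f c [] = c []"
proof -
  have "{xs. map f xs = [] \<and> c xs \<noteq> 0} = (if c [] = 0 then {} else {[]})" by auto
  then show ?thesis by (simp add: pushforward_def)
qed

text \<open>A list over \<open>y # ys\<close> is a preimage of \<open>y\<close> followed by a list
  over \<open>ys\<close>. This recursion reduces statements about pushforwards to functions with the
  first vertex fixed, and hence to induction on the target list.\<close>

lemma pushforward_Cons:
  assumes "finite V" "supported V c"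
  shows "pushforward f c (y # ys) = (\<Sum>x | x \<in> V \<and> f x = y. pushforward f (\<lambda>xs. c (x # xs)) ys)"
proof -
  let ?L = "\<lambda>ys. {xs. set xs \<subseteq> V \<and> map f xs = ys}"
  have "?L (y # ys) = (\<Union>x\<in>{x. x \<in> V \<and> f x = y}. (#) x ` ?L ys)"
    by (auto simp: map_eq_Cons_conv)
  then have "pushforward f c (y # ys) = sum c (\<Union>x\<in>{x. x \<in> V \<and> f x = y}. (#) x ` ?L ys)"
    using pushforward_eq_sum[OF assms, of f "y # ys"] by simp
  also have "\<dots> = (\<Sum>x | x \<in> V \<and> f x = y. sum c ((#) x ` ?L ys))"
    by (rule sum.UNION_disjoint) (use assms(1) finite_lists_map_eq[OF assms(1)] in auto)
  also have "\<dots> = (\<Sum>x | x \<in> V \<and> f x = y. pushforward f (\<lambda>xs. c (x # xs)) ys)"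
    by (simp add: sum.reindex pushforward_eq_sum[OF assms(1) supported_Cons[OF assms(2)]])
  finally show ?thesis .
qed

lemma supported_pushforward:
  "supported V c \<Longrightarrow> f ` V \<subseteq> W \<Longrightarrow> supported W (pushforward f c)"
  unfolding supported_def by (metis image_mono image_set order_trans pushforward_nonzeroE)

text \<open>At the front of the list the coefficient is a double sum of \<open>P\<close> over the
  fibres of \<open>y\<close> and \<open>z\<close>. Since \<open>P\<close> is antisymmetric, swapping
  \<open>y\<close> and \<open>z\<close> changes the sign, and for \<open>y = z\<close> the sum over
  one fibre cancels: this is where degenerate images disappear. A prefix is stripped with
  \<open>pushforward_Cons\<close>, so \<open>c\<close> has to vary in the induction.\<close>

lemma exterior_pushforward:
  fixes c :: "'a list \<Rightarrow> 'k::field"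
  assumes V: "finite V"
  shows "supported V c \<Longrightarrow> exterior c \<Longrightarrow> exterior (pushforward f c)"
proof -
  have "pushforward f c (ps @ y # z # zs) = - pushforward f c (ps @ z # y # zs) \<and>
      pushforward f c (ps @ y # y # zs) = 0" if "supported V c" "exterior c" for c :: "'a list \<Rightarrow> 'k" and ps y z zs
    using that
  proof (induction ps arbitrary: c)
    case Nil
    define P where "P x x' = pushforward f (\<lambda>xs. c (x # x' # xs)) zs" for x x'
    let ?F = "\<lambda>y. {x. x \<in> V \<and> f x = y}"
    have eq: "pushforward f c (y # z # zs) = (\<Sum>x\<in>?F y. \<Sum>x'\<in>?F z. P x x')" for y z
      unfolding P_def
      by (simp add: pushforward_Cons[OF V] Nil.prems supported_Cons)
    have swap: "P x x' = - P x' x" for x x'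
    proof -
      have "(\<lambda>xs. c (x # x' # xs)) = (\<lambda>xs. - c (x' # x # xs))"
        using exterior_swap[OF Nil.prems(2)] by blast
      then show ?thesis unfolding P_def by (simp add: pushforward_uminus)
    qed
    have diag: "P x x = 0" for x
      unfolding P_def by (simp add: exterior_repeat[OF Nil.prems(2)] pushforward_zero)
    have "(\<Sum>x\<in>?F y. \<Sum>x'\<in>?F z. P x x') = (\<Sum>x'\<in>?F z. \<Sum>x\<in>?F y. - P x' x)"
      by (subst sum.swap, subst swap) simp
    then show ?case
      using sum_antisymmetric_eq_0[of P "?F y", OF swap diag] by (simp add: eq sum_negf)
  next
    case (Cons p ps)
    then show ?case
      by (simp add: pushforward_Cons[OF V] supported_Cons exterior_Cons sum_negf)
  qed
  then show "supported V c \<Longrightarrow> exterior c \<Longrightarrow> exterior (pushforward f c)"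
    unfolding exterior_def[of "pushforward f c"] by blast
qed

lemma pushforward_comp:
  assumes "finite V" "supported V c"
  shows "pushforward g (pushforward f c) = pushforward (g \<circ> f) c"
proof
  fix zs
  let ?A = "{xs. set xs \<subseteq> V \<and> map (g \<circ> f) xs = zs}"
  let ?B = "{ys. set ys \<subseteq> f ` V \<and> map g ys = zs}"
  have "pushforward (g \<circ> f) c zs = sum c ?A"
    by (rule pushforward_eq_sum[OF assms])
  \<comment> \<open>Lists over \<open>zs\<close> are grouped by their image under \<open>f\<close>.
    The groups range over all of \<open>?B\<close>, including lists at which
    \<open>pushforward f c\<close> vanishes by cancellation.\<close>
  also have "\<dots> = (\<Sum>ys\<in>?B. sum c {xs \<in> ?A. map f xs = ys})"
  proof (rule sum.group[symmetric])
    show "finite ?A" "finite ?B" using assms(1) by (simp_all add: finite_lists_map_eq)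
    show "map f ` ?A \<subseteq> ?B" by fastforce
  qed
  also have "\<dots> = (\<Sum>ys\<in>?B. pushforward f c ys)"
  proof (rule sum.cong)
    fix ys assume ys: "ys \<in> ?B"
    have "{xs \<in> ?A. map f xs = ys} = {xs. set xs \<subseteq> V \<and> map f xs = ys}"
      using ys by auto
    then show "sum c {xs \<in> ?A. map f xs = ys} = pushforward f c ys"
      by (simp add: pushforward_eq_sum[OF assms])
  qed simp
  also have "\<dots> = pushforward g (pushforward f c) zs"
    by (rule pushforward_eq_sum[symmetric]) (use assms supported_pushforward[OF assms(2)] in auto)
  finally show "pushforward g (pushforward f c) zs = pushforward (g \<circ> f) c zs" ..
qed

lemma pushforward_id: "pushforward (\<lambda>x. x) c = c"
proof
  fix ys
  have "{xs. map (\<lambda>x. x) xs = ys \<and> c xs \<noteq> 0} = (if c ys = 0 then {} else {ys})" by auto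
  then show "pushforward (\<lambda>x. x) c ys = c ys" by (simp add: pushforward_def)
qed

text \<open>The fibres of \<open>f\<close> over \<open>W\<close> partition \<open>V\<close>, so
  summing the fibre sums of \<open>pushforward_Cons\<close> over \<open>W\<close> is summing over
  \<open>V\<close>. The identity holds at the empty list too.\<close>

lemma pushforward_aug_boundary:
  assumes "finite V" "finite W" "supported V c" "f ` V \<subseteq> W"
  shows "pushforward f (aug_boundary V c) ys = aug_boundary W (pushforward f c) ys"
proof -
  let ?P = "\<lambda>x. pushforward f (\<lambda>xs. c (x # xs)) ys"
  have "aug_boundary W (pushforward f c) ys = (\<Sum>y\<in>W. sum ?P {x \<in> V. f x = y})"
    unfolding aug_boundary_def by (simp add: pushforward_Cons[OF assms(1,3)])
  also have "\<dots> = sum ?P V"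
    by (rule sum.group) (use assms in auto)
  also have "\<dots> = pushforward f (aug_boundary V c) ys"
    unfolding aug_boundary_def
    by (rule pushforward_sum[symmetric]) (use assms supported_Cons in auto)
  finally show ?thesis ..
qed


subsection \<open>Exterior multiplication by a vertex\<close>

text \<open>
  The oriented simplex $[v_0,\dots,v_d]$ goes to $[a,v_0,\dots,v_d]$.  The recursion says that
  evaluation at the first vertex is an antiderivation.
\<close>

fun wedge :: "'a \<Rightarrow> ('a list \<Rightarrow> 'k::field) \<Rightarrow> 'a list \<Rightarrow> 'k" where
  "wedge a e [] = 0"
| "wedge a e (y # ys) = (if y = a then e ys else 0) - wedge a (\<lambda>zs. e (y # zs)) ys"

lemma wedge_zero: "wedge a (\<lambda>_. 0) ys = 0"
  by (induction ys) simp_all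

lemma wedge_uminus: "wedge a (\<lambda>zs. - e zs) ys = - wedge a e ys"
  by (induction ys arbitrary: e) simp_all

lemma wedge_sum: "wedge a (\<lambda>zs. \<Sum>i\<in>I. e i zs) ys = (\<Sum>i\<in>I. wedge a (e i) ys)"
proof (induction ys arbitrary: e)
  case (Cons y ys)
  then show ?case by (simp add: sum_subtractf)
qed simp

lemma wedge_nonzeroE:
  assumes "wedge a e ys \<noteq> 0"
  obtains zs where "e zs \<noteq> 0" "length ys = Suc (length zs)" "set ys = insert a (set zs)"
  using assms
proof (induction ys arbitrary: e thesis)
  case (Cons y ys)
  show ?case
  proof (cases "y = a \<and> e ys \<noteq> 0")
    case True
    then show ?thesis using Cons.prems(1)[of ys] by simp
  next
    case False
    then have "wedge a (\<lambda>zs. e (y # zs)) ys \<noteq> 0" using Cons.prems(2) by (auto split: if_splits)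
    then obtain zs where "e (y # zs) \<noteq> 0" "length ys = Suc (length zs)" "set ys = insert a (set zs)"
      by (rule Cons.IH[rotated])
    then show ?thesis using Cons.prems(1)[of "y # zs"] by auto
  qed
qed simp

text \<open>Unfolding the recursion twice at \<open>x # y # zs\<close> gives the difference of an
  indicator term for \<open>x\<close> and the same term for \<open>y\<close>, plus a wedge with
  \<open>e\<close> evaluated at \<open>x\<close>, \<open>y\<close>. Both parts are antisymmetric and
  vanish for \<open>x = y\<close>.\<close>

lemma exterior_wedge:
  fixes e :: "'a list \<Rightarrow> 'k::field"
  assumes "exterior e"
  shows "exterior (wedge a e)"
proof -
  have "wedge a e (ps @ x # y # zs) = - wedge a e (ps @ y # x # zs) \<and>
      wedge a e (ps @ x # x # zs) = 0" if "exterior e" for e :: "'a list \<Rightarrow> 'k" and ps x y zs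
    using that
  proof (induction ps arbitrary: e)
    case Nil
    have "(\<lambda>zs. e (x # y # zs)) = (\<lambda>zs. - e (y # x # zs))"
      using exterior_swap[OF Nil] by blast
    moreover have "(\<lambda>zs. e (x # x # zs)) = (\<lambda>_. 0)"
      using exterior_repeat[OF Nil] by blast
    ultimately show ?case by (simp add: wedge_uminus wedge_zero)
  next
    case (Cons p ps)
    have "e (ps @ x # y # zs) = - e (ps @ y # x # zs)" "e (ps @ x # x # zs) = 0"
      by (rule exteriorD[OF Cons.prems])+
    then show ?case using Cons.IH[OF exterior_Cons[OF Cons.prems, of p]] by simp
  qed
  then show ?thesis using assms unfolding exterior_def[of "wedge a e"] by blast
qed

text \<open>Summing the recursion of \<open>wedge\<close> over the first vertex, the indicator
  selects \<open>a\<close> exactly once. Augmentation matters: if \<open>e\<close> is a 0-chain, the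
  correction term is \<open>a\<close> times the sum of its coefficients.\<close>

lemma aug_boundary_wedge:
  assumes "finite V" "a \<in> V"
  shows "aug_boundary V (wedge a e) ys = e ys - wedge a (aug_boundary V e) ys"
  using assms unfolding aug_boundary_def by (simp add: sum_subtractf wedge_sum)

text \<open>Morally, \<open>c\<close> is \<open>v\<close> wedge its link plus a part without
  \<open>v\<close>. The maps \<open>f\<close> and \<open>g\<close> agree on that part, and also on
  the link, which does not involve \<open>v\<close> because repeated vertices have coefficient 0.
  The induction on \<open>ys\<close> verifies this coefficientwise, so the decomposition of
  \<open>c\<close> is never formed.\<close>

lemma pushforward_change_vertex:
  assumes V: "finite V" "v \<in> V" and fg: "\<And>x. x \<in> V - {v} \<Longrightarrow> f x = g x"
  shows "supported V c \<Longrightarrow> exterior c \<Longrightarrow>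
    pushforward g c ys - pushforward f c ys =
      wedge (g v) (pushforward f (\<lambda>xs. c (v # xs))) ys - wedge (f v) (pushforward f (\<lambda>xs. c (v # xs))) ys"
proof (induction ys arbitrary: c)
  case Nil
  then show ?case by (simp add: pushforward_Nil)
next
  case (Cons y ys)
  let ?e = "pushforward f (\<lambda>xs. c (v # xs))"
  let ?E = "\<lambda>x. pushforward f (\<lambda>xs. c (x # v # xs))"
  let ?I = "{x. x \<in> V - {v} \<and> f x = y}"
  let ?F = "\<lambda>x. pushforward f (\<lambda>xs. c (x # xs)) ys"
  let ?G = "\<lambda>x. pushforward g (\<lambda>xs. c (x # xs)) ys"
  \<comment> \<open>The fibre over \<open>y\<close> consists of \<open>v\<close>, if
    \<open>h v = y\<close>, and of \<open>?I\<close>, which is the same for \<open>f\<close> and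
    \<open>g\<close>.\<close>
  have split: "pushforward h c (y # ys) =
      (if h v = y then pushforward h (\<lambda>xs. c (v # xs)) ys else 0) +
      (\<Sum>x\<in>?I. pushforward h (\<lambda>xs. c (x # xs)) ys)" if "\<And>x. x \<in> V - {v} \<Longrightarrow> h x = f x" for h
  proof -
    have "{x. x \<in> V \<and> h x = y} = (if h v = y then insert v ?I else ?I)"
    proof (rule Set.set_eqI)
      fix x
      show "x \<in> {x. x \<in> V \<and> h x = y} \<longleftrightarrow> x \<in> (if h v = y then insert v ?I else ?I)"
        using that[of x] V(2) by (cases "x = v") auto
    qed
    then show ?thesis using V(1) by (simp add: pushforward_Cons[OF V(1) Cons.prems(1)])
  qed
  have IH: "?G x - ?F x = wedge (g v) (?E x) ys - wedge (f v) (?E x) ys" for x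
    using Cons.IH[of "\<lambda>xs. c (x # xs)"] Cons.prems by (simp add: supported_Cons exterior_Cons)
  have Ev: "?E v = (\<lambda>_. 0)"
    using exterior_repeat[OF Cons.prems(2)] by (simp add: pushforward_zero)
  \<comment> \<open>The induction hypothesis for the link of \<open>v\<close>, whose own link at
    \<open>v\<close> is zero, shows that \<open>f\<close> and \<open>g\<close> push the link forward
    to the same value.\<close>
  then have v: "?G v = ?e ys" using IH[of v] by (simp add: wedge_zero)
  \<comment> \<open>Swapping \<open>v\<close> behind the preimage \<open>x\<close> of
    \<open>y\<close> gives the sign; the term for \<open>x = v\<close> vanishes. The sign matches
    the minus in the recursion of \<open>wedge\<close>.\<close>
  have "(\<lambda>zs. ?e (y # zs)) = (\<lambda>zs. \<Sum>x\<in>?I. - ?E x zs)"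
  proof
    fix zs
    have swap: "pushforward f (\<lambda>xs. c (v # x # xs)) = (\<lambda>zs. - ?E x zs)" for x
      using pushforward_uminus[of f "\<lambda>xs. c (x # v # xs)"] exterior_swap[OF Cons.prems(2), of v x] by simp
    have "?e (y # zs) = (\<Sum>x | x \<in> V \<and> f x = y. - ?E x zs)"
      by (subst pushforward_Cons[OF V(1) supported_Cons[OF Cons.prems(1)]]) (simp add: swap)
    also have "\<dots> = (\<Sum>x\<in>?I. - ?E x zs)"
      by (rule sum.mono_neutral_right) (use V Ev in auto)
    finally show "?e (y # zs) = (\<Sum>x\<in>?I. - ?E x zs)" .
  qed
  then have e: "wedge a (\<lambda>zs. ?e (y # zs)) ys = - (\<Sum>x\<in>?I. wedge a (?E x) ys)" for a
    by (simp add: wedge_sum wedge_uminus sum_negf)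
  have "pushforward g c (y # ys) - pushforward f c (y # ys) =
      (if g v = y then ?e ys else 0) - (if f v = y then ?e ys else 0) + (\<Sum>x\<in>?I. ?G x - ?F x)"
    using split[of g] split[of f] fg v by (simp add: sum_subtractf)
  also have "(\<Sum>x\<in>?I. ?G x - ?F x) =
      (\<Sum>x\<in>?I. wedge (g v) (?E x) ys) - (\<Sum>x\<in>?I. wedge (f v) (?E x) ys)"
    by (simp add: IH sum_subtractf)
  finally show ?case by (simp add: e eq_commute[of y])
qed


section \<open>Chain complexes of finite simplicial complexes\<close>

definition finite_complex :: "'a set set \<Rightarrow> bool" where
  "finite_complex K \<longleftrightarrow> finite (\<Union>K) \<and> {} \<notin> K \<and> (\<forall>\<sigma>\<in>K. \<forall>\<tau>. \<tau> \<noteq> {} \<longrightarrow> \<tau> \<subseteq> \<sigma> \<longrightarrow> \<tau> \<in> K)"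

lemma finite_complexD:
  assumes "finite_complex K"
  shows "finite (\<Union>K)" "\<sigma> \<in> K \<Longrightarrow> \<tau> \<noteq> {} \<Longrightarrow> \<tau> \<subseteq> \<sigma> \<Longrightarrow> \<tau> \<in> K"
  using assms unfolding finite_complex_def by blast+

text \<open>Only finitely many lists of length \<open>Suc d\<close> have their entries in a finite
  vertex set, so finite support is automatic; distinctness is contained in
  \<open>exterior\<close>.\<close>

lemma chains_iff:
  assumes K: "finite_complex K"
  shows "c \<in> chains K d \<longleftrightarrow> exterior c \<and> (\<forall>xs. c xs \<noteq> 0 \<longrightarrow> length xs = Suc d \<and> set xs \<in> K)"
proof -
  have "finite {xs. c xs \<noteq> 0}" if "\<forall>xs. c xs \<noteq> 0 \<longrightarrow> length xs = Suc d \<and> set xs \<in> K"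
    by (rule finite_subset[OF _ finite_lists_length_eq[OF finite_complexD(1)[OF K], of "Suc d"]])
      (use that in blast)
  then show ?thesis
    unfolding chains_def exterior_iff by blast
qed

lemma chains_supported: "c \<in> chains K d \<Longrightarrow> supported (\<Union>K) c"
  unfolding chains_def supported_def by blast

lemma chains_exterior: "c \<in> chains K d \<Longrightarrow> exterior c"
  unfolding chains_def exterior_iff by blast

lemma chains_nonzero:
  assumes "c \<in> chains K d" "c xs \<noteq> 0"
  shows "length xs = Suc d" "set xs \<in> K"
  using assms unfolding chains_def by blast+

lemma chains_zero: "(\<lambda>_. 0) \<in> chains K d"
  by (simp add: chains_def alternating_def)

lemma chains_scale: "c \<in> chains K d \<Longrightarrow> (\<lambda>xs. k * c xs) \<in> chains K d"
  unfolding chains_def alternating_def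
  by (auto elim: rev_finite_subset)

lemma chains_add:
  assumes c: "c \<in> chains K d" and e: "e \<in> chains K d"
  shows "(\<lambda>xs. c xs + e xs) \<in> chains K d"
proof -
  have "finite {xs. c xs + e xs \<noteq> 0}"
    by (rule finite_subset[of _ "{xs. c xs \<noteq> 0} \<union> {xs. e xs \<noteq> 0}"])
      (use c e in \<open>auto simp: chains_def\<close>)
  moreover have "c xs \<noteq> 0 \<or> e xs \<noteq> 0" if "c xs + e xs \<noteq> 0" for xs
    using that by auto
  moreover have "alternating (\<lambda>xs. c xs + e xs)"
    using c e unfolding chains_def alternating_def by simp
  ultimately show ?thesis
    using c e unfolding chains_def by blast
qed

lemma boundary_chain:
  assumes "finite_complex K" "c \<in> chains K d"
  shows "boundary c ys = (if ys = [] then 0 else aug_boundary (\<Union>K) c ys)"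
  by (rule boundary_eq_aug_boundary) (use assms finite_complexD chains_supported in auto)

lemma boundary_zero: "boundary (\<lambda>_. 0) = (\<lambda>_. 0)"
  by (simp add: boundary_def fun_eq_iff)

lemma boundary_scale:
  assumes "finite_complex K" "c \<in> chains K d"
  shows "boundary (\<lambda>xs. k * c xs) = (\<lambda>ys. k * boundary c ys)"
  by (simp add: fun_eq_iff boundary_chain[OF assms] boundary_chain[OF assms(1) chains_scale[OF assms(2)]]
      aug_boundary_def sum_distrib_left)

lemma boundary_add:
  assumes "finite_complex K" "c \<in> chains K d" "e \<in> chains K d"
  shows "boundary (\<lambda>xs. c xs + e xs) = (\<lambda>ys. boundary c ys + boundary e ys)"
  by (simp add: fun_eq_iff boundary_chain[OF assms(1,2)] boundary_chain[OF assms(1,3)]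
      boundary_chain[OF assms(1) chains_add[OF assms(2,3)]] aug_boundary_def sum.distrib)

lemma boundary_chains:
  assumes K: "finite_complex K" and c: "c \<in> chains K (Suc d)"
  shows "boundary c \<in> chains K d"
proof -
  have eq: "boundary c = aug_boundary (\<Union>K) c"
  proof
    fix ys
    show "boundary c ys = aug_boundary (\<Union>K) c ys"
    proof (cases "ys = []")
      case True
      \<comment> \<open>In degree \<open>Suc d\<close> no list of length one carries a coefficient,
        so both boundaries are 0 at the empty list.\<close>
      have "c [x] = 0" for x using chains_nonzero(1)[OF c, of "[x]"] by auto
      then show ?thesis by (simp add: True aug_boundary_def boundary_def)
    qed (simp add: boundary_chain[OF K c])
  qed
  have "length ys = Suc d \<and> set ys \<in> K" if nz: "boundary c ys \<noteq> 0" for ys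
  proof -
    obtain x where x: "c (x # ys) \<noteq> 0"
      using nz unfolding eq aug_boundary_def by (metis sum.neutral)
    have "length ys = Suc d" using chains_nonzero(1)[OF c x] by simp
    moreover have "set ys \<in> K"
      by (rule finite_complexD(2)[OF K chains_nonzero(2)[OF c x]]) (use calculation in auto)
    ultimately show ?thesis ..
  qed
  moreover have "exterior (boundary c)"
    unfolding eq by (rule exterior_aug_boundary[OF chains_exterior[OF c]])
  ultimately show ?thesis by (simp add: chains_iff[OF K])
qed

lemma boundary_boundary:
  assumes K: "finite_complex K" and c: "c \<in> chains K (Suc d)"
  shows "boundary (boundary c) = (\<lambda>_. 0)"
proof
  fix ys
  have "aug_boundary (\<Union>K) (boundary c) ys = aug_boundary (\<Union>K) (aug_boundary (\<Union>K) c) ys"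
    by (simp add: aug_boundary_def boundary_chain[OF K c])
  then show "boundary (boundary c) ys = 0"
    by (simp add: boundary_chain[OF K boundary_chains[OF K c]]
        aug_boundary_aug_boundary[OF chains_exterior[OF c]])
qed

section \<open>Cycles and boundaries are closed under the vector space operations\<close>

lemma cycles_zero: "(\<lambda>_. 0) \<in> cycles K d"
  by (simp add: cycles_def chains_zero boundary_zero)

lemma cycles_add:
  "finite_complex K \<Longrightarrow> c \<in> cycles K d \<Longrightarrow> e \<in> cycles K d \<Longrightarrow> (\<lambda>xs. c xs + e xs) \<in> cycles K d"
  by (simp add: cycles_def chains_add boundary_add[of K _ d])

lemma cycles_scale: "finite_complex K \<Longrightarrow> c \<in> cycles K d \<Longrightarrow> (\<lambda>xs. k * c xs) \<in> cycles K d"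
  by (simp add: cycles_def chains_scale boundary_scale[of K _ d])

lemma boundaries_subset_cycles: "finite_complex K \<Longrightarrow> boundaries K d \<subseteq> cycles K d"
  by (auto simp: boundaries_def cycles_def boundary_chains boundary_boundary)

lemma boundaries_zero: "(\<lambda>_. 0) \<in> boundaries K d"
  unfolding boundaries_def
  by (rule image_eqI[where x = "\<lambda>_. 0"]) (simp_all add: boundary_zero chains_zero)

lemma boundaries_add:
  assumes "finite_complex K" "b \<in> boundaries K d" "b' \<in> boundaries K d"
  shows "(\<lambda>xs. b xs + b' xs) \<in> boundaries K d"
proof -
  obtain c c' where c: "c \<in> chains K (Suc d)" "b = boundary c"
    and c': "c' \<in> chains K (Suc d)" "b' = boundary c'"
    using assms unfolding boundaries_def by blast
  show ?thesis
    unfolding boundaries_def c(2) c'(2) boundary_add[OF assms(1) c(1) c'(1), symmetric]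
    by (rule imageI[OF chains_add[OF c(1) c'(1)]])
qed

lemma boundaries_scale:
  assumes "finite_complex K" "b \<in> boundaries K d"
  shows "(\<lambda>xs. k * b xs) \<in> boundaries K d"
proof -
  obtain c where c: "c \<in> chains K (Suc d)" "b = boundary c"
    using assms unfolding boundaries_def by blast
  show ?thesis
    unfolding boundaries_def c(2) boundary_scale[OF assms(1) c(1), symmetric]
    by (rule imageI[OF chains_scale[OF c(1)]])
qed

subsection \<open>Simplicial maps\<close>

lemma simplicial_map_vertices:
  assumes "simplicial_map K L f"
  shows "f ` \<Union>K \<subseteq> \<Union>L"
  using assms unfolding simplicial_map_def by blast

lemma pushforward_chains:
  assumes K: "finite_complex K" and L: "finite_complex L" and f: "simplicial_map K L f"
    and c: "c \<in> chains K d"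
  shows "pushforward f c \<in> chains L d"
proof -
  have "exterior (pushforward f c)"
    using finite_complexD(1)[OF K] chains_supported[OF c] chains_exterior[OF c]
    by (rule exterior_pushforward)
  moreover have "length ys = Suc d \<and> set ys \<in> L" if nz: "pushforward f c ys \<noteq> 0" for ys
  proof -
    obtain xs where "map f xs = ys" "c xs \<noteq> 0" using nz by (rule pushforward_nonzeroE)
    then show ?thesis
      using chains_nonzero[OF c, of xs] f unfolding simplicial_map_def by auto
  qed
  ultimately show ?thesis by (simp add: chains_iff[OF L])
qed

lemma boundary_pushforward:
  assumes K: "finite_complex K" and L: "finite_complex L" and f: "simplicial_map K L f"
    and c: "c \<in> chains K d"
  shows "boundary (pushforward f c) = pushforward f (boundary c)"
proof
  fix ys
  show "boundary (pushforward f c) ys = pushforward f (boundary c) ys"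
  proof (cases "ys = []")
    case True
    then show ?thesis by (simp add: boundary_def pushforward_Nil)
  next
    case False
    have "boundary (pushforward f c) ys = aug_boundary (\<Union>L) (pushforward f c) ys"
      using False by (simp add: boundary_chain[OF L pushforward_chains[OF assms]])
    also have "\<dots> = pushforward f (aug_boundary (\<Union>K) c) ys"
      by (rule pushforward_aug_boundary[symmetric])
        (use finite_complexD(1) K L chains_supported[OF c] simplicial_map_vertices[OF f] in auto)
    \<comment> \<open>Lists mapped to a nonempty \<open>ys\<close> are nonempty, and there the two
      boundaries agree.\<close>
    also have "\<dots> = pushforward f (boundary c) ys"
      by (rule pushforward_cong) (use False in \<open>auto simp: boundary_chain[OF K c]\<close>)
    finally show ?thesis .
  qed
qed

lemma pushforward_cycles:
  assumes "finite_complex K" "finite_complex L" "simplicial_map K L f" "c \<in> cycles K d"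
  shows "pushforward f c \<in> cycles L d"
  using assms unfolding cycles_def
  by (auto simp: boundary_pushforward[of K L f _ d] pushforward_zero intro: pushforward_chains)

lemma pushforward_boundaries:
  assumes "finite_complex K" "finite_complex L" "simplicial_map K L f" "b \<in> boundaries K d"
  shows "pushforward f b \<in> boundaries L d"
proof -
  obtain c where c: "c \<in> chains K (Suc d)" "b = boundary c"
    using assms unfolding boundaries_def by blast
  show ?thesis
    unfolding boundaries_def c(2) boundary_pushforward[OF assms(1-3) c(1), symmetric]
    by (rule imageI[OF pushforward_chains[OF assms(1-3) c(1)]])
qed


subsection \<open>Contiguous maps\<close>

text \<open>
  If \<open>f\<close> and \<open>g\<close> differ only at the vertex \<open>v\<close>, the prism over a simplex $[v,v_1,\dots,v_d]$
  is the single simplex $[f v,g v,f v_1,\dots,f v_d]$, so no ordering of the vertices is needed.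
\<close>

lemma change_vertex_boundary:
  assumes K: "finite_complex K" and L: "finite_complex L"
    and fg: "\<And>x. x \<in> \<Union>K - {v} \<Longrightarrow> f x = g x"
    and contiguous: "\<And>\<sigma>. \<sigma> \<in> K \<Longrightarrow> f ` \<sigma> \<union> g ` \<sigma> \<in> L"
    and c: "c \<in> cycles K d"
  shows "(\<lambda>ys. pushforward g c ys - pushforward f c ys) \<in> boundaries L d"
proof (cases "v \<in> \<Union>K")
  case False
  have cc: "c \<in> chains K d" using c by (simp add: cycles_def)
  have "pushforward g c = pushforward f c"
  proof (rule pushforward_map_cong[OF chains_supported[OF cc]])
    show "g x = f x" if "x \<in> \<Union>K" for x
      using fg[of x] that False by (cases "x = v") auto
  qed
  then show ?thesis by (simp add: boundaries_zero)
next
  case True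
  have cc: "c \<in> chains K d" using c by (simp add: cycles_def)
  note V = finite_complexD(1)[OF K] and W = finite_complexD(1)[OF L]
  note supp = chains_supported[OF cc] and alt = chains_exterior[OF cc]
  \<comment> \<open>This is the link of \<open>v\<close> pushed forward. For \<open>d = 0\<close> it
    is concentrated on the empty list, hence not a chain of \<open>L\<close>; only \<open>?h\<close>
    has to be one.\<close>
  let ?e = "pushforward f (\<lambda>xs. c (v # xs))"
  let ?h = "wedge (f v) (wedge (g v) ?e)"
  have ab: "f v \<in> \<Union>L" "g v \<in> \<Union>L" using True contiguous by blast+
  have fVW: "f ` \<Union>K \<subseteq> \<Union>L" using contiguous by blast
  have h: "?h \<in> chains L (Suc d)"
  proof -
    have "exterior ?h"
      by (intro exterior_wedge exterior_pushforward[OF V] supported_Cons[OF supp] exterior_Cons[OF alt])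
    moreover have "length ys = Suc (Suc d) \<and> set ys \<in> L" if nz: "?h ys \<noteq> 0" for ys
    proof -
      obtain us where us: "wedge (g v) ?e us \<noteq> 0" "length ys = Suc (length us)"
          "set ys = insert (f v) (set us)"
        using nz by (rule wedge_nonzeroE)
      obtain zs where zs: "?e zs \<noteq> 0" "length us = Suc (length zs)" "set us = insert (g v) (set zs)"
        using us(1) by (rule wedge_nonzeroE)
      obtain xs where xs: "map f xs = zs" "c (v # xs) \<noteq> 0"
        using zs(1) by (rule pushforward_nonzeroE)
      have "set (v # xs) \<in> K" "length (v # xs) = Suc d"
        using chains_nonzero[OF cc xs(2)] by auto
      \<comment> \<open>The vertices of \<open>ys\<close> are \<open>f v\<close>, \<open>g v\<close>
        and the \<open>f\<close>-images of \<open>xs\<close>, a face of the joint image of the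
        simplex \<open>v # xs\<close>.\<close>
      moreover from this have "set ys \<in> L"
        by (intro finite_complexD(2)[OF L contiguous[of "set (v # xs)"]])
          (use us zs xs in auto)
      ultimately show ?thesis using us zs xs by auto
    qed
    ultimately show ?thesis by (simp add: chains_iff[OF L])
  qed
  have e: "aug_boundary (\<Union>L) ?e = (\<lambda>_. 0)"
  proof
    fix zs
    \<comment> \<open>One swap turns this sum into minus the coefficient of
      \<open>boundary c\<close> at the nonempty list \<open>v # xs\<close>.\<close>
    have "aug_boundary (\<Union>K) (\<lambda>xs. c (v # xs)) xs = 0" for xs
    proof -
      have "boundary c (v # xs) = 0" using c by (simp add: cycles_def)
      then have "(\<Sum>x\<in>\<Union>K. c (x # v # xs)) = 0"
        by (simp add: boundary_chain[OF K cc] aug_boundary_def)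
      moreover have "c (v # x # xs) = - c (x # v # xs)" for x
        by (rule exterior_swap[OF alt])
      ultimately show ?thesis by (simp add: aug_boundary_def sum_negf)
    qed
    then show "aug_boundary (\<Union>L) ?e zs = 0"
      using pushforward_aug_boundary[OF V W supported_Cons[OF supp] fVW, of v zs]
      by (simp add: pushforward_cong[of f zs _ "\<lambda>_. 0"] pushforward_zero)
  qed
  have "boundary ?h = (\<lambda>ys. pushforward g c ys - pushforward f c ys)"
  proof
    fix ys
    have diff: "pushforward g c ys - pushforward f c ys = wedge (g v) ?e ys - wedge (f v) ?e ys"
      by (rule pushforward_change_vertex[OF V True fg supp alt])
    show "boundary ?h ys = pushforward g c ys - pushforward f c ys"
    \<comment> \<open>At the empty list \<open>boundary\<close> is 0 by convention, and both
      pushforwards have the value \<open>c []\<close>.\<close>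
    proof (cases "ys = []")
      case True
      then show ?thesis by (simp add: boundary_def pushforward_Nil)
    next
      case False
      have "aug_boundary (\<Union>L) (wedge (g v) ?e) = ?e"
        by (rule ext) (simp add: aug_boundary_wedge[OF W ab(2)] e wedge_zero)
      then show ?thesis
        using False diff by (simp add: boundary_chain[OF L h] aug_boundary_wedge[OF W ab(1)])
    qed
  qed
  moreover have "boundary ?h \<in> boundaries L d"
    unfolding boundaries_def using h by (rule imageI)
  ultimately show ?thesis by simp
qed

text \<open>The map \<open>h S\<close> is already switched to \<open>g\<close> on \<open>S\<close>
  and is still \<open>f\<close> elsewhere. Two successive ones differ at one vertex, and together
  they send a simplex \<sigma> into the joint image of \<sigma> under \<open>f\<close> and
  \<open>g\<close>; so they are again contiguous, and the differences telescope.\<close>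

lemma contiguous_homologous:
  assumes K: "finite_complex K" and L: "finite_complex L"
    and contiguous: "\<And>\<sigma>. \<sigma> \<in> K \<Longrightarrow> f ` \<sigma> \<union> g ` \<sigma> \<in> L"
    and c: "c \<in> cycles K d"
  shows "(\<lambda>ys. pushforward g c ys - pushforward f c ys) \<in> boundaries L d"
proof -
  define h where "h S x = (if x \<in> S then g x else f x)" for S x
  have "(\<lambda>ys. pushforward (h S) c ys - pushforward f c ys) \<in> boundaries L d" if "finite S" for S
    using that
  proof (induction S)
    case empty
    then show ?case by (simp add: h_def boundaries_zero)
  next
    case (insert v S)
    have "(\<lambda>ys. pushforward (h (insert v S)) c ys - pushforward (h S) c ys) \<in> boundaries L d"
    proof (rule change_vertex_boundary[OF K L _ _ c])
      show "h S x = h (insert v S) x" if "x \<in> \<Union>K - {v}" for x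
        using that by (simp add: h_def)
      show "h S ` \<sigma> \<union> h (insert v S) ` \<sigma> \<in> L" if "\<sigma> \<in> K" for \<sigma>
      proof (rule finite_complexD(2)[OF L contiguous[OF that]])
        show "h S ` \<sigma> \<union> h (insert v S) ` \<sigma> \<noteq> {}"
          using that K unfolding finite_complex_def by auto
      qed (auto simp: h_def)
    qed
    from boundaries_add[OF L this insert.IH] show ?case by simp
  qed
  from this[OF finite_complexD(1)[OF K]]
  have "(\<lambda>ys. pushforward (h (\<Union>K)) c ys - pushforward f c ys) \<in> boundaries L d" .
  moreover have "pushforward (h (\<Union>K)) c = pushforward g c"
    by (rule pushforward_map_cong[of "\<Union>K"]) (use c chains_supported in \<open>auto simp: cycles_def h_def\<close>)
  ultimately show ?thesis by simp
qed


section \<open>Quotient spaces\<close>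

text \<open>Closure under negation comes from scalar multiplication by -1.\<close>

lemma (in Module.module) submodule_abelian_subgroup:
  assumes W: "submodule R W M"
  shows "abelian_subgroup W M"
proof (rule abelian_subgroupI3)
  interpret W: submodule R W M by (rule W)
  have "subgroup W (add_monoid M)"
  proof (rule subgroup.intro)
    fix w assume w: "w \<in> W"
    then have "(\<ominus>\<^bsub>R\<^esub> \<one>\<^bsub>R\<^esub>) \<odot>\<^bsub>M\<^esub> w \<in> W"
      by (intro W.smult_closed R.add.inv_closed R.one_closed)
    moreover have "(\<ominus>\<^bsub>R\<^esub> \<one>\<^bsub>R\<^esub>) \<odot>\<^bsub>M\<^esub> w = \<ominus>\<^bsub>M\<^esub> w"
      using smult_l_minus[of "\<one>\<^bsub>R\<^esub>" w] smult_one[of w] w W.subset by auto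
    ultimately show "inv\<^bsub>add_monoid M\<^esub> w \<in> W" by (simp add: a_inv_def)
  qed (use W.subset in auto)
  then show "additive_subgroup W M" by (rule additive_subgroup.intro)
  show "abelian_group M" ..
qed

lemma quotient_space_carrier: "carrier (quotient_space V W) = (\<lambda>v. W +>\<^bsub>V\<^esub> v) ` carrier V"
  by (auto simp: quotient_space_def A_RCOSETS_def')

text \<open>Scalar multiplication in \<open>quotient_space\<close> is a union over all
  representatives. They all yield the same coset, so the union collapses to it.\<close>

lemma (in Module.module) quotient_space_operations:
  assumes W: "submodule R W M"
  shows "\<zero>\<^bsub>quotient_space M W\<^esub> = W +>\<^bsub>M\<^esub> \<zero>\<^bsub>M\<^esub>"
    and "x \<in> carrier M \<Longrightarrow> y \<in> carrier M \<Longrightarrow>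
      (W +>\<^bsub>M\<^esub> x) \<oplus>\<^bsub>quotient_space M W\<^esub> (W +>\<^bsub>M\<^esub> y) = W +>\<^bsub>M\<^esub> (x \<oplus>\<^bsub>M\<^esub> y)"
    and "a \<in> carrier R \<Longrightarrow> x \<in> carrier M \<Longrightarrow>
      a \<odot>\<^bsub>quotient_space M W\<^esub> (W +>\<^bsub>M\<^esub> x) = W +>\<^bsub>M\<^esub> (a \<odot>\<^bsub>M\<^esub> x)"
proof -
  interpret W: submodule R W M by (rule W)
  interpret sub: abelian_subgroup W M by (rule submodule_abelian_subgroup[OF W])
  show "\<zero>\<^bsub>quotient_space M W\<^esub> = W +>\<^bsub>M\<^esub> \<zero>\<^bsub>M\<^esub>"
    by (simp add: quotient_space_def a_coset_join2 sub.a_subgroup)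
  show "(W +>\<^bsub>M\<^esub> x) \<oplus>\<^bsub>quotient_space M W\<^esub> (W +>\<^bsub>M\<^esub> y) = W +>\<^bsub>M\<^esub> (x \<oplus>\<^bsub>M\<^esub> y)"
    if "x \<in> carrier M" "y \<in> carrier M"
    using that by (simp add: quotient_space_def sub.a_rcos_sum)
  assume a: "a \<in> carrier R" and x: "x \<in> carrier M"
  have "(\<Union>y\<in>W +>\<^bsub>M\<^esub> x. W +>\<^bsub>M\<^esub> (a \<odot>\<^bsub>M\<^esub> y)) = W +>\<^bsub>M\<^esub> (a \<odot>\<^bsub>M\<^esub> x)"
  proof (rule SUP_eq_const)
    show "W +>\<^bsub>M\<^esub> x \<noteq> {}" using sub.a_rcos_self[OF x] by blast
    fix y assume "y \<in> W +>\<^bsub>M\<^esub> x"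
    then obtain w where w: "w \<in> W" "y = w \<oplus>\<^bsub>M\<^esub> x" by (auto simp: a_r_coset_def')
    have "a \<odot>\<^bsub>M\<^esub> y = a \<odot>\<^bsub>M\<^esub> w \<oplus>\<^bsub>M\<^esub> a \<odot>\<^bsub>M\<^esub> x"
      using a x w W.subset by (auto intro: smult_r_distr)
    also have "\<dots> \<in> W +>\<^bsub>M\<^esub> (a \<odot>\<^bsub>M\<^esub> x)"
      by (rule a_rcosI) (use a x w W.subset in auto)
    finally show "W +>\<^bsub>M\<^esub> (a \<odot>\<^bsub>M\<^esub> y) = W +>\<^bsub>M\<^esub> (a \<odot>\<^bsub>M\<^esub> x)"
      using sub.a_repr_independence' a x by (metis smult_closed)
  qed
  then show "a \<odot>\<^bsub>quotient_space M W\<^esub> (W +>\<^bsub>M\<^esub> x) = W +>\<^bsub>M\<^esub> (a \<odot>\<^bsub>M\<^esub> x)"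
    by (simp add: quotient_space_def)
qed

lemma (in Module.module) quotient_space_module:
  assumes W: "submodule R W M"
  shows "Module.module R (quotient_space M W)"
proof (rule moduleI)
  note [simp] = quotient_space_carrier quotient_space_operations[OF W]
  show "cring R" ..
  show "abelian_group (quotient_space M W)"
  proof (rule abelian_groupI)
    fix A assume "A \<in> carrier (quotient_space M W)"
    then obtain x where x: "x \<in> carrier M" "A = W +>\<^bsub>M\<^esub> x" by auto
    then have "(W +>\<^bsub>M\<^esub> (\<ominus>\<^bsub>M\<^esub> x)) \<oplus>\<^bsub>quotient_space M W\<^esub> A = \<zero>\<^bsub>quotient_space M W\<^esub>"
      by (simp add: M.l_neg)
    then show "\<exists>B\<in>carrier (quotient_space M W). B \<oplus>\<^bsub>quotient_space M W\<^esub> A = \<zero>\<^bsub>quotient_space M W\<^esub>"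
      using x by (metis M.a_inv_closed imageI quotient_space_carrier)
  qed (auto simp: M.a_ac)
qed (auto simp: quotient_space_carrier quotient_space_operations[OF W] smult_l_distr smult_r_distr smult_assoc1)

lemma (in vectorspace) quotient_space_vectorspace:
  "submodule K W V \<Longrightarrow> vectorspace K (quotient_space V W)"
  by (intro vectorspace.intro quotient_space_module field_axioms)

text \<open>The union over representatives avoids a choice and has the same shape as
  \<open>homology_map\<close>; it is a single coset once \<open>F\<close> maps \<open>W\<close> into
  \<open>W'\<close>.\<close>

definition quotient_map ::
  "('k, 'v, 'm) module_scheme \<Rightarrow> 'v set \<Rightarrow> ('k, 'w, 'n) module_scheme \<Rightarrow> 'w set \<Rightarrow> ('v \<Rightarrow> 'w) \<Rightarrow>
     'v set \<Rightarrow> 'w set" where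
  "quotient_map V W V' W' F = (\<lambda>A\<in>carrier (quotient_space V W). \<Union>v\<in>A. W' +>\<^bsub>V'\<^esub> F v)"

lemma quotient_map_coset:
  assumes W: "submodule R W V" and W': "submodule R W' V'"
    and F: "F \<in> LinearCombinations.module_hom R V V'" and FW: "F ` W \<subseteq> W'" and v: "v \<in> carrier V"
  shows "quotient_map V W V' W' F (W +>\<^bsub>V\<^esub> v) = W' +>\<^bsub>V'\<^esub> F v"
proof -
  interpret W: submodule R W V by (rule W)
  interpret W': submodule R W' V' by (rule W')
  interpret V: Module.module R V by (rule W.module)
  interpret V': Module.module R V' by (rule W'.module)
  interpret sub: abelian_subgroup W V by (rule V.submodule_abelian_subgroup[OF W])
  interpret sub': abelian_subgroup W' V' by (rule V'.submodule_abelian_subgroup[OF W'])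
  have Fv: "F v \<in> carrier V'" using F v by (auto simp: LinearCombinations.module_hom_def)
  have "(\<Union>u\<in>W +>\<^bsub>V\<^esub> v. W' +>\<^bsub>V'\<^esub> F u) = W' +>\<^bsub>V'\<^esub> F v"
  proof (rule SUP_eq_const)
    show "W +>\<^bsub>V\<^esub> v \<noteq> {}" using sub.a_rcos_self[OF v] by blast
    fix u assume "u \<in> W +>\<^bsub>V\<^esub> v"
    then obtain w where w: "w \<in> W" "u = w \<oplus>\<^bsub>V\<^esub> v" by (auto simp: a_r_coset_def')
    have "F u = F w \<oplus>\<^bsub>V'\<^esub> F v"
      using F v w W.subset by (auto simp: LinearCombinations.module_hom_def)
    also have "\<dots> \<in> W' +>\<^bsub>V'\<^esub> F v"
      using w FW by (intro V'.a_rcosI Fv W'.subset) auto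
    finally show "W' +>\<^bsub>V'\<^esub> F u = W' +>\<^bsub>V'\<^esub> F v"
      using sub'.a_repr_independence' Fv by metis
  qed
  then show ?thesis using v by (simp add: quotient_map_def quotient_space_carrier)
qed

lemma quotient_map_linear:
  assumes V: "vectorspace K V" and V': "vectorspace K V'"
    and W: "submodule K W V" and W': "submodule K W' V'"
    and F: "F \<in> LinearCombinations.module_hom K V V'" and FW: "F ` W \<subseteq> W'"
  shows "linear_map K (quotient_space V W) (quotient_space V' W') (quotient_map V W V' W' F)"
proof -
  interpret V: vectorspace K V by (rule V)
  interpret V': vectorspace K V' by (rule V')
  interpret Q: vectorspace K "quotient_space V W" by (rule V.quotient_space_vectorspace[OF W])
  interpret Q': vectorspace K "quotient_space V' W'" by (rule V'.quotient_space_vectorspace[OF W'])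
  note [simp] = quotient_space_carrier V.quotient_space_operations[OF W]
    V'.quotient_space_operations[OF W'] quotient_map_coset[OF W W' F FW]
  have Fv: "F v \<in> carrier V'" if "v \<in> carrier V" for v
    using F that by (auto simp: LinearCombinations.module_hom_def)
  have "quotient_map V W V' W' F \<in> LinearCombinations.module_hom K (quotient_space V W) (quotient_space V' W')"
    using F Fv unfolding LinearCombinations.module_hom_def by auto
  then show ?thesis
    by (intro linear_map.intro mod_hom.intro mod_hom_axioms.intro Q.vectorspace_axioms
        Q'.vectorspace_axioms Q.module_axioms Q'.module_axioms)
qed


section \<open>Functoriality of homology\<close>

abbreviation cycle_space :: "'a set set \<Rightarrow> nat \<Rightarrow> ('k::field, 'a list \<Rightarrow> 'k) module" where
  "cycle_space K d \<equiv> chain_space K d\<lparr>carrier := cycles K d\<rparr>"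

lemma cycle_space_vectorspace:
  assumes K: "finite_complex K"
  shows "vectorspace (class_ring :: 'k::field ring) (cycle_space K d)"
proof (rule vectorspace.intro)
  show "Module.module (class_ring :: 'k ring) (cycle_space K d)"
  proof (rule moduleI)
    show "cring (class_ring :: 'k ring)" ..
    show "abelian_group (cycle_space K d :: ('k, _) module)"
    proof (rule abelian_groupI)
      fix c :: "'a list \<Rightarrow> 'k"
      assume "c \<in> carrier (cycle_space K d)"
      then have "(\<lambda>xs. -1 * c xs) \<in> cycles K d" by (intro cycles_scale[OF K]) simp
      then show "\<exists>e\<in>carrier (cycle_space K d). e \<oplus>\<^bsub>cycle_space K d\<^esub> c = \<zero>\<^bsub>cycle_space K d\<^esub>"
        by (intro bexI[of _ "\<lambda>xs. -1 * c xs"]) (simp_all add: chain_space_def)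
    qed (auto simp: chain_space_def cycles_add[OF K] cycles_zero algebra_simps)
  qed (auto simp: chain_space_def cycles_scale[OF K] algebra_simps)
qed (rule class_field)

lemma boundaries_submodule:
  assumes K: "finite_complex K"
  shows "submodule (class_ring :: 'k::field ring) (boundaries K d) (cycle_space K d)"
proof (rule submodule.intro)
  interpret V: vectorspace "class_ring :: 'k ring" "cycle_space K d"
    by (rule cycle_space_vectorspace[OF K])
  show "Module.module (class_ring :: 'k ring) (cycle_space K d)" by (rule V.module_axioms)
qed (use boundaries_subset_cycles[OF K] in
    \<open>auto simp: chain_space_def boundaries_zero boundaries_add[OF K] boundaries_scale[OF K]\<close>)

definition homology_class :: "'a set set \<Rightarrow> nat \<Rightarrow> ('a list \<Rightarrow> 'k::field) \<Rightarrow> ('a list \<Rightarrow> 'k) set" where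
  "homology_class K d c = boundaries K d +>\<^bsub>cycle_space K d\<^esub> c"

lemma carrier_homology: "carrier (homology K d) = homology_class K d ` cycles K d"
  by (simp add: homology_def quotient_space_carrier homology_class_def)

lemma homology_class_eqI:
  fixes c e :: "'a list \<Rightarrow> 'k::field"
  assumes K: "finite_complex K" and e: "e \<in> cycles K d"
    and diff: "(\<lambda>xs. c xs - e xs) \<in> boundaries K d"
  shows "homology_class K d c = homology_class K d e"
proof -
  interpret V: vectorspace "class_ring :: 'k ring" "cycle_space K d"
    by (rule cycle_space_vectorspace[OF K])
  interpret sub: abelian_subgroup "boundaries K d :: ('a list \<Rightarrow> 'k) set" "cycle_space K d"
    by (rule V.submodule_abelian_subgroup[OF boundaries_submodule[OF K]])
  have "c = (\<lambda>xs. c xs - e xs) \<oplus>\<^bsub>cycle_space K d\<^esub> e"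
    by (simp add: chain_space_def)
  then have "c \<in> boundaries K d +>\<^bsub>cycle_space K d\<^esub> e"
    unfolding a_r_coset_def' using diff by blast
  then show ?thesis
    unfolding homology_class_def by (rule sub.a_repr_independence'[symmetric]) (simp add: e)
qed

text \<open>\<open>homology_map\<close> forms its cosets in the chain space, the quotient in the
  cycle space. Cosets depend only on the addition, which the two spaces share.\<close>

lemma homology_map_eq_quotient_map:
  "homology_map K L d f =
     quotient_map (cycle_space K d) (boundaries K d) (cycle_space L d) (boundaries L d) (pushforward f)"
  by (simp add: homology_map_def quotient_map_def homology_def a_r_coset_def' chain_space_def)

lemma pushforward_module_hom:
  assumes K: "finite_complex K" and L: "finite_complex L" and f: "simplicial_map K L f"
  shows "pushforward f \<in> LinearCombinations.module_hom (class_ring :: 'k::field ring)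
    (cycle_space K d) (cycle_space L d)"
proof -
  have "supported (\<Union>K) c" if "c \<in> cycles K d" for c :: "'a list \<Rightarrow> 'k"
    using that chains_supported unfolding cycles_def by blast
  then show ?thesis
    unfolding LinearCombinations.module_hom_def
    by (auto simp: chain_space_def pushforward_scale pushforward_cycles[OF K L f]
        pushforward_add[OF finite_complexD(1)[OF K]])
qed

lemma homology_map_class:
  fixes c :: "'a list \<Rightarrow> 'k::field"
  assumes K: "finite_complex K" and L: "finite_complex L" and f: "simplicial_map K L f"
    and c: "c \<in> cycles K d"
  shows "homology_map K L d f (homology_class K d c) = homology_class L d (pushforward f c)"
  unfolding homology_map_eq_quotient_map homology_class_def
  by (rule quotient_map_coset[OF boundaries_submodule[OF K] boundaries_submodule[OF L]
        pushforward_module_hom[OF K L f]])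
    (use pushforward_boundaries[OF K L f] c in auto)

lemma homology_map_linear:
  assumes K: "finite_complex K" and L: "finite_complex L" and f: "simplicial_map K L f"
  shows "linear_map (class_ring :: 'k::field ring) (homology K d) (homology L d) (homology_map K L d f)"
  unfolding homology_map_eq_quotient_map homology_def
  by (rule quotient_map_linear[OF cycle_space_vectorspace[OF K] cycle_space_vectorspace[OF L]
        boundaries_submodule[OF K] boundaries_submodule[OF L] pushforward_module_hom[OF K L f]])
    (use pushforward_boundaries[OF K L f] in auto)

text \<open>Every element of homology is the class of a cycle, so an extensional map is determined
  by its values on classes. Identity, composition and contiguity are all reduced to cycles in this
  way.\<close>

lemma homology_map_eqI:
  assumes K: "finite_complex K" and L: "finite_complex L" and f: "simplicial_map K L f"
    and h: "h \<in> extensional (carrier (homology K d))"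
    and "\<And>c. c \<in> cycles K d \<Longrightarrow> h (homology_class K d c) = homology_class L d (pushforward f c)"
  shows "homology_map K L d f = h"
proof (rule extensionalityI)
  show "homology_map K L d f \<in> extensional (carrier (homology K d))"
    by (simp add: homology_map_def)
  show "homology_map K L d f A = h A" if "A \<in> carrier (homology K d)" for A
    using that assms(5) by (auto simp: carrier_homology homology_map_class[OF K L f])
qed (rule h)

lemma homology_map_id:
  assumes K: "finite_complex K"
  shows "homology_map K K d (\<lambda>x. x) = (\<lambda>A\<in>carrier (homology K d). A)"
  by (rule homology_map_eqI[OF K K])
    (auto simp: simplicial_map_def carrier_homology pushforward_id)

lemma simplicial_map_comp:
  "simplicial_map K L f \<Longrightarrow> simplicial_map L M g \<Longrightarrow> simplicial_map K M (g \<circ> f)"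
  unfolding simplicial_map_def image_comp[symmetric] by blast

lemma homology_map_comp:
  assumes K: "finite_complex K" and L: "finite_complex L" and M: "finite_complex M"
    and f: "simplicial_map K L f" and g: "simplicial_map L M g"
  shows "homology_map K M d (g \<circ> f) =
    compose (carrier (homology K d :: ('k::field, _) module)) (homology_map L M d g) (homology_map K L d f)"
proof (rule homology_map_eqI[OF K M simplicial_map_comp[OF f g]])
  fix c :: "'a list \<Rightarrow> 'k"
  assume c: "c \<in> cycles K d"
  then have "supported (\<Union>K) c" by (auto simp: cycles_def chains_supported)
  then have "pushforward g (pushforward f c) = pushforward (g \<circ> f) c"
    by (rule pushforward_comp[OF finite_complexD(1)[OF K]])
  then show "compose (carrier (homology K d)) (homology_map L M d g) (homology_map K L d f)
      (homology_class K d c) = homology_class M d (pushforward (g \<circ> f) c)"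
    using c pushforward_cycles[OF K L f c]
    by (simp add: compose_def carrier_homology homology_map_class[OF K L f] homology_map_class[OF L M g])
qed simp

lemma homology_map_contiguous:
  assumes K: "finite_complex K" and L: "finite_complex L"
    and f: "simplicial_map K L f" and g: "simplicial_map K L g"
    and contiguous: "\<And>\<sigma>. \<sigma> \<in> K \<Longrightarrow> f ` \<sigma> \<union> g ` \<sigma> \<in> L"
  shows "(homology_map K L d g :: ('a list \<Rightarrow> 'k::field) set \<Rightarrow> _) = homology_map K L d f"
proof (rule homology_map_eqI[OF K L g])
  show "homology_map K L d f (homology_class K d c) = homology_class L d (pushforward g c)"
    if "c \<in> cycles K d" for c :: "'a list \<Rightarrow> 'k"
    unfolding homology_map_class[OF K L f that]
    by (rule homology_class_eqI[OF L, symmetric])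
      (use that pushforward_cycles[OF K L f] contiguous_homologous[OF K L contiguous] in auto)
qed (simp add: homology_map_def)


section \<open>Persistent homology of data sets\<close>

lemma vietoris_rips_iff:
  "\<sigma> \<in> vietoris_rips r S \<delta> \<longleftrightarrow>
     \<sigma> \<noteq> {} \<and> finite \<sigma> \<and> \<sigma> \<subseteq> S \<and> (\<forall>x\<in>\<sigma>. \<forall>y\<in>\<sigma>. \<delta> x y \<le> r)"
proof -
  have "finite_diameter \<delta> \<sigma> \<le> r \<longleftrightarrow> (\<forall>x\<in>\<sigma>. \<forall>y\<in>\<sigma>. \<delta> x y \<le> r)" if "\<sigma> \<noteq> {}" "finite \<sigma>"
    unfolding finite_diameter_def using that by (subst Max_le_iff) auto
  then show ?thesis unfolding vietoris_rips_def by blast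
qed

text \<open>The measurement \<phi> guarantees that \<open>Max\<close> in \<open>data_dist\<close> is
  taken over a nonempty set; otherwise its value is unspecified.\<close>

lemma VR_iff:
  assumes \<Phi>: "is_data_set \<Phi>" and \<phi>: "\<phi> \<in> measurements \<Phi>"
  shows "\<sigma> \<in> VR \<Phi> \<phi> r s \<longleftrightarrow> \<sigma> \<noteq> {} \<and> \<sigma> \<subseteq> sublevel \<Phi> \<phi> s \<and>
     (\<forall>x\<in>\<sigma>. \<forall>y\<in>\<sigma>. \<forall>\<chi>\<in>measurements \<Phi>. \<bar>\<chi> x - \<chi> y\<bar> \<le> r)"
proof -
  have "data_dist \<Phi> x y \<le> r \<longleftrightarrow> (\<forall>\<chi>\<in>measurements \<Phi>. \<bar>\<chi> x - \<chi> y\<bar> \<le> r)" for x y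
    unfolding data_dist_def using assms by (subst Max_le_iff) (auto simp: is_data_set_def)
  moreover have "finite \<sigma>" if "\<sigma> \<subseteq> sublevel \<Phi> \<phi> s"
    using that \<Phi> unfolding is_data_set_def sublevel_def by (auto intro: finite_subset)
  ultimately show ?thesis by (auto simp: vietoris_rips_iff)
qed

lemma finite_complex_VR:
  assumes "is_data_set \<Phi>"
  shows "finite_complex (VR \<Phi> \<phi> r s)"
proof -
  have "\<Union>(VR \<Phi> \<phi> r s) \<subseteq> ds_domain \<Phi>" by (auto simp: vietoris_rips_iff sublevel_def)
  then have "finite (\<Union>(VR \<Phi> \<phi> r s))"
    using assms finite_subset unfolding is_data_set_def by blast
  then show ?thesis
    unfolding finite_complex_def by (auto simp: vietoris_rips_iff subset_iff intro: finite_subset)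
qed

lemma simplicial_map_VR_inclusion:
  assumes "r \<le> r'" "s \<le> s'"
  shows "simplicial_map (VR \<Phi> \<phi> r s) (VR \<Phi> \<phi> r' s') (\<lambda>x. x)"
  unfolding simplicial_map_def
  by (auto simp: vietoris_rips_iff sublevel_def subset_iff
      intro: order_trans[OF _ assms(1)] order_trans[OF _ assms(2)])

lemma persistence_functor_PH:
  assumes "is_data_set \<Phi>"
  shows "persistence_functor (PH d \<Phi> \<phi> :: real \<Rightarrow> real \<Rightarrow> ('k::field, _) module) (PH_transition d \<Phi> \<phi>)"
proof -
  note complex = finite_complex_VR[OF assms] and incl = simplicial_map_VR_inclusion
  show ?thesis
    unfolding persistence_functor_def PH_def PH_transition_def
  proof (intro conjI allI impI)
    fix r s r' s' r'' s'' :: real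
    assume "r \<le> r'" "r' \<le> r''" "s \<le> s'" "s' \<le> s''"
    then show "homology_map (VR \<Phi> \<phi> r s) (VR \<Phi> \<phi> r'' s'') d (\<lambda>x. x) =
        compose (carrier (homology (VR \<Phi> \<phi> r s) d :: ('k, _) module))
          (homology_map (VR \<Phi> \<phi> r' s') (VR \<Phi> \<phi> r'' s'') d (\<lambda>x. x))
          (homology_map (VR \<Phi> \<phi> r s) (VR \<Phi> \<phi> r' s') d (\<lambda>x. x))"
      using homology_map_comp[OF complex complex complex incl incl, of r r' s s' r'' s'']
      by (simp add: comp_def)
  qed (simp_all add: homology_map_linear complex incl homology_map_id)
qed

section \<open>Realizations and the maps they induce on persistent homology\<close>

lemma realization_apply:
  "realization \<Phi> \<Psi> \<alpha> f \<Longrightarrow> \<chi> \<in> measurements \<Phi> \<Longrightarrow> y \<in> ds_domain \<Psi> \<Longrightarrow> \<alpha> \<chi> y = \<chi> (f y)"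
  by (simp add: realization_def compose_def)

lemma realization_sublevel:
  assumes "realization \<Phi> \<Psi> \<alpha> f" "\<phi> \<in> measurements \<Phi>"
  shows "f ` sublevel \<Psi> (\<alpha> \<phi>) s \<subseteq> sublevel \<Phi> \<phi> s"
proof (rule image_subsetI)
  fix y assume y: "y \<in> sublevel \<Psi> (\<alpha> \<phi>) s"
  then have "f y \<in> ds_domain \<Phi>"
    using assms(1) unfolding realization_def sublevel_def by blast
  then show "f y \<in> sublevel \<Phi> \<phi> s"
    using y realization_apply[OF assms, of y] by (simp add: sublevel_def)
qed

lemma geometric_measurement: "geometric \<Phi> \<Psi> \<alpha> \<Longrightarrow> \<phi> \<in> measurements \<Phi> \<Longrightarrow> \<alpha> \<phi> \<in> measurements \<Psi>"
  by (auto simp: geometric_def)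

lemma realizations_contiguous:
  assumes \<Phi>: "is_data_set \<Phi>" and \<Psi>: "is_data_set \<Psi>" and \<alpha>: "geometric \<Phi> \<Psi> \<alpha>"
    and \<phi>: "\<phi> \<in> measurements \<Phi>"
    and f: "realization \<Phi> \<Psi> \<alpha> f" and g: "realization \<Phi> \<Psi> \<alpha> g" and \<sigma>: "\<sigma> \<in> VR \<Psi> (\<alpha> \<phi>) r s"
  shows "f ` \<sigma> \<union> g ` \<sigma> \<in> VR \<Phi> \<phi> r s"
proof -
  have \<sigma>': "\<sigma> \<noteq> {}" "\<sigma> \<subseteq> sublevel \<Psi> (\<alpha> \<phi>) s"
    and diam: "\<And>x y \<chi>. x \<in> \<sigma> \<Longrightarrow> y \<in> \<sigma> \<Longrightarrow> \<chi> \<in> measurements \<Psi> \<Longrightarrow> \<bar>\<chi> x - \<chi> y\<bar> \<le> r"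
    using \<sigma>[unfolded VR_iff[OF \<Psi> geometric_measurement[OF \<alpha> \<phi>]]] by auto
  have dom: "y \<in> ds_domain \<Psi>" if "y \<in> \<sigma>" for y
    using that \<sigma>' by (auto simp: sublevel_def)
  \<comment> \<open>One \<open>y\<close> serves all \<chi> at once, whether \<open>x\<close> comes
    from \<open>f\<close> or from \<open>g\<close>. Distances within the joint image are thereby
    bounded by distances within \<sigma>.\<close>
  have source: "\<exists>y\<in>\<sigma>. \<forall>\<chi>\<in>measurements \<Phi>. \<chi> x = \<alpha> \<chi> y"
    if x: "x \<in> f ` \<sigma> \<union> g ` \<sigma>" for x
  proof -
    obtain y where y: "y \<in> \<sigma>" "x = f y \<or> x = g y" using x by blast
    then have "\<chi> x = \<alpha> \<chi> y" if "\<chi> \<in> measurements \<Phi>" for \<chi>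
      using realization_apply[OF f that dom] realization_apply[OF g that dom] by metis
    then show ?thesis using y(1) by blast
  qed
  have "\<bar>\<chi> x - \<chi> x'\<bar> \<le> r"
    if x: "x \<in> f ` \<sigma> \<union> g ` \<sigma>" and x': "x' \<in> f ` \<sigma> \<union> g ` \<sigma>" and \<chi>: "\<chi> \<in> measurements \<Phi>"
    for x x' \<chi>
  proof -
    obtain y y' where "y \<in> \<sigma>" "\<chi> x = \<alpha> \<chi> y" "y' \<in> \<sigma>" "\<chi> x' = \<alpha> \<chi> y'"
      using source[OF x] source[OF x'] \<chi> by blast
    then show ?thesis using diam[OF _ _ geometric_measurement[OF \<alpha> \<chi>]] by simp
  qed
  moreover have "f ` \<sigma> \<union> g ` \<sigma> \<subseteq> sublevel \<Phi> \<phi> s"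
    using \<sigma>'(2) realization_sublevel[OF f \<phi>, of s] realization_sublevel[OF g \<phi>, of s] by blast
  ultimately show ?thesis
    using \<sigma>'(1) unfolding VR_iff[OF \<Phi> \<phi>] by simp
qed

text \<open>This is the contiguity of \<open>f\<close> with itself.\<close>

lemma realization_simplicial:
  assumes "is_data_set \<Phi>" "is_data_set \<Psi>" "geometric \<Phi> \<Psi> \<alpha>" "\<phi> \<in> measurements \<Phi>"
    and "realization \<Phi> \<Psi> \<alpha> f"
  shows "simplicial_map (VR \<Psi> (\<alpha> \<phi>) r s) (VR \<Phi> \<phi> r s) f"
  using realizations_contiguous[OF assms(1-4) assms(5) assms(5)]
  unfolding simplicial_map_def by simp

lemma realization_map_unique:
  assumes "is_data_set \<Phi>" "is_data_set \<Psi>" "geometric \<Phi> \<Psi> \<alpha>" "\<phi> \<in> measurements \<Phi>"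
    and "realization \<Phi> \<Psi> \<alpha> f" "realization \<Phi> \<Psi> \<alpha> g"
  shows "realization_map d \<Phi> \<Psi> \<alpha> \<phi> r s f = realization_map d \<Phi> \<Psi> \<alpha> \<phi> r s g"
  using assms
  by (intro homology_map_contiguous finite_complex_VR realization_simplicial realizations_contiguous)

text \<open>Independence of the realization makes the definite description in \<open>PH_map\<close>
  meaningful; all later statements are then proved for one chosen realization.\<close>

lemma PH_map_eq:
  assumes "is_data_set \<Phi>" "is_data_set \<Psi>" "geometric \<Phi> \<Psi> \<alpha>" "\<phi> \<in> measurements \<Phi>"
    and "realization \<Phi> \<Psi> \<alpha> f"
  shows "PH_map d \<Phi> \<Psi> \<alpha> \<phi> r s = realization_map d \<Phi> \<Psi> \<alpha> \<phi> r s f"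
  unfolding PH_map_def
proof (rule the_equality)
  show "\<exists>g. realization \<Phi> \<Psi> \<alpha> g \<and> realization_map d \<Phi> \<Psi> \<alpha> \<phi> r s f = realization_map d \<Phi> \<Psi> \<alpha> \<phi> r s g"
    using assms(5) by blast
next
  fix h assume "\<exists>g. realization \<Phi> \<Psi> \<alpha> g \<and> h = realization_map d \<Phi> \<Psi> \<alpha> \<phi> r s g"
  then obtain g where "realization \<Phi> \<Psi> \<alpha> g" "h = realization_map d \<Phi> \<Psi> \<alpha> \<phi> r s g" by blast
  then show "h = realization_map d \<Phi> \<Psi> \<alpha> \<phi> r s f"
    using realization_map_unique[OF assms(1-4) _ assms(5)] by simp
qed

lemma realization_map_linear:
  assumes "is_data_set \<Phi>" "is_data_set \<Psi>" "geometric \<Phi> \<Psi> \<alpha>" "\<phi> \<in> measurements \<Phi>"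
    and "realization \<Phi> \<Psi> \<alpha> f"
  shows "linear_map (class_ring :: 'k::field ring) (PH d \<Psi> (\<alpha> \<phi>) r s) (PH d \<Phi> \<phi> r s)
    (realization_map d \<Phi> \<Psi> \<alpha> \<phi> r s f)"
  unfolding PH_def using assms
  by (intro homology_map_linear finite_complex_VR realization_simplicial)

text \<open>The inclusions are identities on vertices, so both composites are the homology map of
  the same vertex map \<open>f\<close> from the source complex at (r, s) to the target complex at
  (r', s').\<close>

lemma PH_map_natural:
  assumes \<Phi>: "is_data_set \<Phi>" and \<Psi>: "is_data_set \<Psi>" and \<alpha>: "geometric \<Phi> \<Psi> \<alpha>"
    and \<phi>: "\<phi> \<in> measurements \<Phi>"
  shows "natural_transformation
    (PH d \<Psi> (\<alpha> \<phi>) :: real \<Rightarrow> real \<Rightarrow> ('k::field, _) module) (PH_transition d \<Psi> (\<alpha> \<phi>))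
    (PH d \<Phi> \<phi>) (PH_transition d \<Phi> \<phi>) (PH_map d \<Phi> \<Psi> \<alpha> \<phi>)"
proof -
  obtain f where f: "realization \<Phi> \<Psi> \<alpha> f" using \<alpha> by (auto simp: geometric_def)
  note map = PH_map_eq[OF \<Phi> \<Psi> \<alpha> \<phi> f] and simplicial = realization_simplicial[OF \<Phi> \<Psi> \<alpha> \<phi> f]
  note complex = finite_complex_VR[OF \<Phi>] finite_complex_VR[OF \<Psi>]
  have "compose (carrier (PH d \<Psi> (\<alpha> \<phi>) r s :: ('k, _) module))
        (PH_transition d \<Phi> \<phi> r s r' s') (PH_map d \<Phi> \<Psi> \<alpha> \<phi> r s) =
      compose (carrier (PH d \<Psi> (\<alpha> \<phi>) r s))
        (PH_map d \<Phi> \<Psi> \<alpha> \<phi> r' s') (PH_transition d \<Psi> (\<alpha> \<phi>) r s r' s')"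
    if "r \<le> r'" "s \<le> s'" for r s r' s'
    unfolding PH_def PH_transition_def map
    by (simp add: comp_def
        homology_map_comp[OF complex(2,1,1) simplicial simplicial_map_VR_inclusion[OF that], symmetric]
        homology_map_comp[OF complex(2,2,1) simplicial_map_VR_inclusion[OF that] simplicial, symmetric])
  then show ?thesis
    unfolding natural_transformation_def
    by (simp add: map persistence_functor_PH \<Phi> \<Psi> realization_map_linear[OF \<Phi> \<Psi> \<alpha> \<phi> f])
qed

section \<open>Composition of geometric functions\<close>

lemma realization_comp:
  assumes f: "realization \<Phi> \<Psi> \<alpha> f" and g: "realization \<Psi> \<Xi> \<beta> g" and \<alpha>: "geometric \<Phi> \<Psi> \<alpha>"
  shows "realization \<Phi> \<Xi> (\<beta> \<circ> \<alpha>) (f \<circ> g)"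
proof -
  have g_dom: "g z \<in> ds_domain \<Psi>" if "z \<in> ds_domain \<Xi>" for z
    using g that by (auto simp: realization_def)
  have "(\<beta> \<circ> \<alpha>) \<phi> = compose (ds_domain \<Xi>) \<phi> (f \<circ> g)" if \<phi>: "\<phi> \<in> measurements \<Phi>" for \<phi>
  proof -
    have "(\<beta> \<circ> \<alpha>) \<phi> = compose (ds_domain \<Xi>) (\<alpha> \<phi>) g"
      using g geometric_measurement[OF \<alpha> \<phi>] by (simp add: realization_def)
    \<comment> \<open>The values of \<open>g\<close> lie in the domain of \<Psi>, where
      \<open>\<alpha> \<phi>\<close> is really given by \<open>f\<close> and not by the default
      value \<open>undefined\<close>.\<close>
    also have "\<dots> = compose (ds_domain \<Xi>) \<phi> (f \<circ> g)"
      unfolding compose_def by (rule restrict_ext) (simp add: realization_apply[OF f \<phi> g_dom])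
    finally show ?thesis .
  qed
  then show ?thesis using f g_dom by (auto simp: realization_def)
qed

lemma geometric_comp:
  assumes "geometric \<Phi> \<Psi> \<alpha>" "geometric \<Psi> \<Xi> \<beta>"
  shows "geometric \<Phi> \<Xi> (\<beta> \<circ> \<alpha>)"
  using assms realization_comp[OF _ _ assms(1)] unfolding geometric_def by fastforce

text \<open>Evaluating all three maps on \<open>f\<close>, \<open>g\<close> and the realization
  \<open>f \<circ> g\<close> of \<open>\<beta> \<circ> \<alpha>\<close> turns the identity into
  functoriality of homology.\<close>

lemma PH_map_comp:
  assumes \<Phi>: "is_data_set \<Phi>" and \<Psi>: "is_data_set \<Psi>" and \<Xi>: "is_data_set \<Xi>"
    and \<alpha>: "geometric \<Phi> \<Psi> \<alpha>" and \<beta>: "geometric \<Psi> \<Xi> \<beta>" and \<phi>: "\<phi> \<in> measurements \<Phi>"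
  shows "(PH_map d \<Phi> \<Xi> (\<beta> \<circ> \<alpha>) \<phi> r s :: ('z list \<Rightarrow> 'k::field) set \<Rightarrow> _) =
    compose (carrier (PH d \<Xi> (\<beta> (\<alpha> \<phi>)) r s))
      (PH_map d \<Phi> \<Psi> \<alpha> \<phi> r s) (PH_map d \<Psi> \<Xi> \<beta> (\<alpha> \<phi>) r s)"
proof -
  obtain f g where f: "realization \<Phi> \<Psi> \<alpha> f" and g: "realization \<Psi> \<Xi> \<beta> g"
    using \<alpha> \<beta> by (auto simp: geometric_def)
  note \<alpha>\<phi> = geometric_measurement[OF \<alpha> \<phi>]
  show ?thesis
    unfolding PH_map_eq[OF \<Phi> \<Psi> \<alpha> \<phi> f] PH_map_eq[OF \<Psi> \<Xi> \<beta> \<alpha>\<phi> g]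
      PH_map_eq[OF \<Phi> \<Xi> geometric_comp[OF \<alpha> \<beta>] \<phi> realization_comp[OF f g \<alpha>]] PH_def comp_apply[of \<beta> \<alpha> \<phi>]
    by (rule homology_map_comp[OF finite_complex_VR[OF \<Xi>] finite_complex_VR[OF \<Psi>]
          finite_complex_VR[OF \<Phi>] realization_simplicial[OF \<Psi> \<Xi> \<beta> \<alpha>\<phi> g]
          realization_simplicial[OF \<Phi> \<Psi> \<alpha> \<phi> f]])
qed

theorem mainTheorem1:
  fixes d :: nat
    and \<Phi> :: "'x data_set" and \<Psi> :: "'y data_set"
    and \<alpha> :: "('x \<Rightarrow> real) \<Rightarrow> ('y \<Rightarrow> real)"
  assumes "is_data_set \<Phi>" and "is_data_set \<Psi>" and "geometric \<Phi> \<Psi> \<alpha>"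
  shows
    "(\<forall>\<phi>\<in>measurements \<Phi>. \<forall>r\<ge>0. \<forall>s f. realization \<Phi> \<Psi> \<alpha> f \<longrightarrow>
        f ` sublevel \<Psi> (\<alpha> \<phi>) s \<subseteq> sublevel \<Phi> \<phi> s \<and>
        simplicial_map (VR \<Psi> (\<alpha> \<phi>) r s) (VR \<Phi> \<phi> r s) f \<and>
        linear_map (class_ring :: 'k::field ring) (PH d \<Psi> (\<alpha> \<phi>) r s) (PH d \<Phi> \<phi> r s)
          (realization_map d \<Phi> \<Psi> \<alpha> \<phi> r s f) \<and>
        (\<forall>g. realization \<Phi> \<Psi> \<alpha> g \<longrightarrow>
           (realization_map d \<Phi> \<Psi> \<alpha> \<phi> r s f
              :: ('y list \<Rightarrow> 'k) set \<Rightarrow> ('x list \<Rightarrow> 'k) set) =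
           realization_map d \<Phi> \<Psi> \<alpha> \<phi> r s g) \<and>
        (PH_map d \<Phi> \<Psi> \<alpha> \<phi> r s :: ('y list \<Rightarrow> 'k) set \<Rightarrow> ('x list \<Rightarrow> 'k) set) =
          realization_map d \<Phi> \<Psi> \<alpha> \<phi> r s f)
     \<and>
     (\<forall>\<phi>\<in>measurements \<Phi>.
        natural_transformation
          (PH d \<Psi> (\<alpha> \<phi>) :: real \<Rightarrow> real \<Rightarrow> ('k, ('y list \<Rightarrow> 'k) set) module)
          (PH_transition d \<Psi> (\<alpha> \<phi>))
          (PH d \<Phi> \<phi>) (PH_transition d \<Phi> \<phi>)
          (PH_map d \<Phi> \<Psi> \<alpha> \<phi>))
     \<and>
     (\<forall>(\<Xi> :: 'z data_set) \<beta>. is_data_set \<Xi> \<longrightarrow> geometric \<Psi> \<Xi> \<beta> \<longrightarrow>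
        geometric \<Phi> \<Xi> (\<beta> \<circ> \<alpha>) \<and>
        (\<forall>\<phi>\<in>measurements \<Phi>. \<forall>r\<ge>0. \<forall>s.
           (PH_map d \<Phi> \<Xi> (\<beta> \<circ> \<alpha>) \<phi> r s
              :: ('z list \<Rightarrow> 'k) set \<Rightarrow> ('x list \<Rightarrow> 'k) set) =
           compose (carrier (PH d \<Xi> (\<beta> (\<alpha> \<phi>)) r s))
             (PH_map d \<Phi> \<Psi> \<alpha> \<phi> r s) (PH_map d \<Psi> \<Xi> \<beta> (\<alpha> \<phi>) r s)))"
proof (intro conjI ballI allI impI)
  fix \<phi> :: "'x \<Rightarrow> real" and r s :: real and f
  assume \<phi>: "\<phi> \<in> measurements \<Phi>" and f: "realization \<Phi> \<Psi> \<alpha> f"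
  show "f ` sublevel \<Psi> (\<alpha> \<phi>) s \<subseteq> sublevel \<Phi> \<phi> s"
    by (rule realization_sublevel[OF f \<phi>])
  show "simplicial_map (VR \<Psi> (\<alpha> \<phi>) r s) (VR \<Phi> \<phi> r s) f"
    by (rule realization_simplicial[OF assms \<phi> f])
  show "linear_map (class_ring :: 'k ring) (PH d \<Psi> (\<alpha> \<phi>) r s) (PH d \<Phi> \<phi> r s)
      (realization_map d \<Phi> \<Psi> \<alpha> \<phi> r s f)"
    by (rule realization_map_linear[OF assms \<phi> f])
  show "(realization_map d \<Phi> \<Psi> \<alpha> \<phi> r s f :: ('y list \<Rightarrow> 'k) set \<Rightarrow> ('x list \<Rightarrow> 'k) set) =
      realization_map d \<Phi> \<Psi> \<alpha> \<phi> r s g" if "realization \<Phi> \<Psi> \<alpha> g" for g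
    by (rule realization_map_unique[OF assms \<phi> f that])
  show "(PH_map d \<Phi> \<Psi> \<alpha> \<phi> r s :: ('y list \<Rightarrow> 'k) set \<Rightarrow> ('x list \<Rightarrow> 'k) set) =
      realization_map d \<Phi> \<Psi> \<alpha> \<phi> r s f"
    by (rule PH_map_eq[OF assms \<phi> f])
next
  fix \<phi> assume "\<phi> \<in> measurements \<Phi>"
  then show "natural_transformation
      (PH d \<Psi> (\<alpha> \<phi>) :: real \<Rightarrow> real \<Rightarrow> ('k, ('y list \<Rightarrow> 'k) set) module)
      (PH_transition d \<Psi> (\<alpha> \<phi>)) (PH d \<Phi> \<phi>) (PH_transition d \<Phi> \<phi>) (PH_map d \<Phi> \<Psi> \<alpha> \<phi>)"
    by (rule PH_map_natural[OF assms])
next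
  fix \<Xi> :: "'z data_set" and \<beta>
  assume \<Xi>: "is_data_set \<Xi>" and \<beta>: "geometric \<Psi> \<Xi> \<beta>"
  show "geometric \<Phi> \<Xi> (\<beta> \<circ> \<alpha>)"
    by (rule geometric_comp[OF assms(3) \<beta>])
  show "(PH_map d \<Phi> \<Xi> (\<beta> \<circ> \<alpha>) \<phi> r s :: ('z list \<Rightarrow> 'k) set \<Rightarrow> ('x list \<Rightarrow> 'k) set) =
      compose (carrier (PH d \<Xi> (\<beta> (\<alpha> \<phi>)) r s))
        (PH_map d \<Phi> \<Psi> \<alpha> \<phi> r s) (PH_map d \<Psi> \<Xi> \<beta> (\<alpha> \<phi>) r s)"
    if "\<phi> \<in> measurements \<Phi>" for \<phi> r s
    by (rule PH_map_comp[OF assms(1,2) \<Xi> assms(3) \<beta> that])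
qed

end
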